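(* Let $\Bbbk$ be a field of characteristic $p>0$, let $V$ be an $n$-dimensional $\Bbbk$-vector space, and let $G\subseteq \mathrm{GL}(V)$ be a finite $p$-group that is a generalised Nakajima group. Let $S=\mathrm{Sym}\,V^*$. If $S^G$ is a direct summand of $S$ as an $S^G$-module, then $S^G$ is a polynomial ring over $\Bbbk$.
   Context: $G$ acts on $V^*$ by $(gx)(v)=x(g^{-1}v)$, and this extends to an action on $S=\mathrm{Sym}\,V^*$ by graded $\Bbbk$-algebra automorphisms; $S^G$ is the ring of invariants. Given an ordered basis $x_1,\ldots,x_n$ of $V^*$ and $g\in G$, put $\beta_g=\max\{j\mid x_j \text{ appears (with nonzero coefficient) in } gx_i-x_i\text{ for some } i\}$ (with $\beta_g=0$ if $g$ is the identity). $G$ is a generalised Nakajima group if there exist an ordered basis $\{x_1,\ldots,x_n\}$ of $V^*$ and a sequence of integers $1\leq i_0<i_1<\cdots<i_r\leq n$ ($r<n$) such that: (a) $gx_i-x_i\in\Bbbk\langle x_1,\ldots,x_{i-1}\rangle$ for all $g\in G$ and all $i=1,\ldots,n$; (b) $G$ is generated as a group by $P_1\cup P_2\cup\cdots\cup P_r$, where, for $k=1,\ldots,r$, $P_k$ is the subgroup of $G$ generated by $\{g\in G\mid \text{if } gx_i\neq x_i \text{ then } i_{k-1}<i\leq i_k \text{ and } \beta_g\leq i_{k-1}\}$. *)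

theory Defs
  imports
    "HOL-Algebra.Algebra"
    "HOL-Library.Poly_Mapping"
    "HOL-Library.Function_Algebras"
begin

section \<open>Linear groups and the dual representation\<close>

definition GL :: "('k::field \<Rightarrow> 'v::ab_group_add \<Rightarrow> 'v) \<Rightarrow> ('v \<Rightarrow> 'v) monoid" where
  "GL scale = \<lparr>carrier = {g. Vector_Spaces.linear scale scale g \<and> bij g},
     monoid.mult = (\<circ>), one = id\<rparr>"

definition dual :: "('k::field \<Rightarrow> 'v::ab_group_add \<Rightarrow> 'v) \<Rightarrow> ('v \<Rightarrow> 'k) set" where
  "dual scale = {x. Vector_Spaces.linear scale (*) x}"

definition dual_scale :: "'k::field \<Rightarrow> ('v \<Rightarrow> 'k) \<Rightarrow> ('v \<Rightarrow> 'k)" where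
  "dual_scale c x = (\<lambda>v. c * x v)"

definition dual_act :: "('v \<Rightarrow> 'v) \<Rightarrow> ('v \<Rightarrow> 'k::field) \<Rightarrow> ('v \<Rightarrow> 'k)" where
  "dual_act g x = (\<lambda>v. x (inv_into UNIV g v))"

section \<open>Generalised Nakajima groups\<close>

text \<open>Ordered bases \<open>x\<^sub>1, \<dots>, x\<^sub>n\<close> are functions on \<open>nat\<close> of which only the values on \<open>{1..n}\<close> matter.\<close>

definition ordered_dual_basis ::
    "('k::field \<Rightarrow> 'v::ab_group_add \<Rightarrow> 'v) \<Rightarrow> nat \<Rightarrow> (nat \<Rightarrow> 'v \<Rightarrow> 'k) \<Rightarrow> bool" where
  "ordered_dual_basis scale n x \<longleftrightarrow>
     inj_on x {1..n} \<and>
     \<not> module.dependent dual_scale (x ` {1..n}) \<and>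
     module.span dual_scale (x ` {1..n}) = dual scale"

definition nakajima_beta :: "nat \<Rightarrow> (nat \<Rightarrow> 'v \<Rightarrow> 'k::field) \<Rightarrow> ('v \<Rightarrow> 'v) \<Rightarrow> nat" where
  "nakajima_beta n x g =
     Max (insert 0 {j \<in> {1..n}. \<exists>i\<in>{1..n}.
       module.representation dual_scale (x ` {1..n}) (dual_act g (x i) - x i) (x j) \<noteq> 0})"

definition nakajima_block ::
    "('k::field \<Rightarrow> 'v::ab_group_add \<Rightarrow> 'v) \<Rightarrow> nat \<Rightarrow> ('v \<Rightarrow> 'v) set \<Rightarrow> (nat \<Rightarrow> 'v \<Rightarrow> 'k)
      \<Rightarrow> (nat \<Rightarrow> nat) \<Rightarrow> nat \<Rightarrow> ('v \<Rightarrow> 'v) set" where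
  "nakajima_block scale n G x idx k =
     generate (GL scale)
       {g \<in> G. \<forall>i\<in>{1..n}. dual_act g (x i) \<noteq> x i \<longrightarrow>
          idx (k - 1) < i \<and> i \<le> idx k \<and> nakajima_beta n x g \<le> idx (k - 1)}"

definition generalised_nakajima ::
    "('k::field \<Rightarrow> 'v::ab_group_add \<Rightarrow> 'v) \<Rightarrow> nat \<Rightarrow> ('v \<Rightarrow> 'v) set \<Rightarrow> bool" where
  "generalised_nakajima scale n G \<longleftrightarrow>
     (\<exists>x idx r. ordered_dual_basis scale n x \<and>
        r < n \<and> 1 \<le> idx 0 \<and> (\<forall>k<r. idx k < idx (Suc k)) \<and> idx r \<le> n \<and>
        (\<forall>g\<in>G. \<forall>i\<in>{1..n}. dual_act g (x i) - x i \<in> module.span dual_scale (x ` {1..<i})) \<and>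
        G = generate (GL scale) (\<Union>k\<in>{1..r}. nakajima_block scale n G x idx k))"

section \<open>Polynomial rings and symmetric algebras\<close>

text \<open>Polynomials over \<open>'k\<close> in variables of type \<open>'w\<close>: finitely supported coefficient functions on
  finitely supported exponent vectors. The ring \<open>poly_ring W\<close> uses only the variables in \<open>W\<close>.\<close>

type_synonym ('w, 'k) mpolynomial = "('w \<Rightarrow>\<^sub>0 nat) \<Rightarrow>\<^sub>0 'k"

definition const_poly :: "'k::field \<Rightarrow> ('w, 'k) mpolynomial" where
  "const_poly c = Poly_Mapping.single 0 c"

definition indet :: "'w \<Rightarrow> ('w, 'k::field) mpolynomial" where
  "indet w = Poly_Mapping.single (Poly_Mapping.single w 1) 1"

definition poly_ring :: "'w set \<Rightarrow> ('w, 'k::field) mpolynomial ring" where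
  "poly_ring W =
     \<lparr>carrier = {p. \<forall>m\<in>Poly_Mapping.keys p. Poly_Mapping.keys m \<subseteq> W},
      monoid.mult = (*), one = 1, ring.zero = 0, ring.add = (+)\<rparr>"

text \<open>The \<open>'k\<close>-algebra endomorphism that substitutes the variable \<open>f w\<close> for the variable \<open>w\<close>.\<close>

definition rename_vars :: "('w \<Rightarrow> 'w) \<Rightarrow> ('w, 'k::field) mpolynomial \<Rightarrow> ('w, 'k) mpolynomial" where
  "rename_vars f p =
     (\<Sum>m\<in>Poly_Mapping.keys p. const_poly (Poly_Mapping.lookup p m) *
        (\<Prod>w\<in>Poly_Mapping.keys m. indet (f w) ^ Poly_Mapping.lookup m w))"

text \<open>The symmetric algebra of a vector space \<open>W\<close> is the free commutative algebra on the set \<open>W\<close>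
  modulo the relations that make \<open>w \<mapsto> indet w\<close> linear.\<close>

definition sym_ideal ::
    "('k::field \<Rightarrow> 'w::ab_group_add \<Rightarrow> 'w) \<Rightarrow> 'w set \<Rightarrow> ('w, 'k) mpolynomial set" where
  "sym_ideal sc W =
     genideal (poly_ring W)
       ({indet (u + w) - (indet u + indet w) | u w. u \<in> W \<and> w \<in> W} \<union>
        {indet (sc c w) - const_poly c * indet w | c w. w \<in> W})"

definition sym_algebra ::
    "('k::field \<Rightarrow> 'w::ab_group_add \<Rightarrow> 'w) \<Rightarrow> 'w set \<Rightarrow> ('w, 'k) mpolynomial set ring" where
  "sym_algebra sc W = poly_ring W Quot sym_ideal sc W"

definition sym_constant ::
    "('k::field \<Rightarrow> 'w::ab_group_add \<Rightarrow> 'w) \<Rightarrow> 'w set \<Rightarrow> 'k \<Rightarrow> ('w, 'k) mpolynomial set" where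
  "sym_constant sc W c = sym_ideal sc W +>\<^bsub>poly_ring W\<^esub> const_poly c"

text \<open>Elements of the symmetric algebra are cosets of \<open>sym_ideal\<close>. For \<open>g \<in> GL(V)\<close> renaming the
  variables along the dual action maps this ideal onto itself, hence cosets onto cosets, and so is
  the algebra automorphism of \<open>Sym V\<^sup>*\<close> extending the action on \<open>V\<^sup>*\<close>.\<close>

definition sym_act ::
    "('v \<Rightarrow> 'v) \<Rightarrow> ('v \<Rightarrow> 'k::field, 'k) mpolynomial set \<Rightarrow> ('v \<Rightarrow> 'k, 'k) mpolynomial set" where
  "sym_act g s = rename_vars (dual_act g) ` s"

definition Sym_dual ::
    "('k::field \<Rightarrow> 'v::ab_group_add \<Rightarrow> 'v) \<Rightarrow> ('v \<Rightarrow> 'k, 'k) mpolynomial set ring" where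
  "Sym_dual scale = sym_algebra dual_scale (dual scale)"

definition invariant_ring ::
    "('k::field \<Rightarrow> 'v::ab_group_add \<Rightarrow> 'v) \<Rightarrow> ('v \<Rightarrow> 'v) set
      \<Rightarrow> ('v \<Rightarrow> 'k, 'k) mpolynomial set ring" where
  "invariant_ring scale G =
     (Sym_dual scale)\<lparr>carrier := {s \<in> carrier (Sym_dual scale). \<forall>g\<in>G. sym_act g s = s}\<rparr>"

section \<open>Direct summands and polynomial algebras\<close>

definition direct_summand ::
    "'m set \<Rightarrow> ('r, 'a) ring_scheme \<Rightarrow> ('r, 'm, 'b) module_scheme \<Rightarrow> bool" where
  "direct_summand A R M \<longleftrightarrow>
     submodule A R M \<and>
     (\<exists>N. submodule N R M \<and> A \<inter> N = {\<zero>\<^bsub>M\<^esub>} \<and> set_add M A N = carrier M)"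

definition regular_module :: "'a ring \<Rightarrow> ('a, 'a) module" where
  "regular_module S =
     \<lparr>carrier = carrier S, monoid.mult = monoid.mult S, one = one S,
      ring.zero = ring.zero S, ring.add = ring.add S, smult = monoid.mult S\<rparr>"

text \<open>A \<open>'k\<close>-algebra is given by a ring \<open>R\<close> together with its structure map \<open>\<iota>\<close> from \<open>'k\<close>.\<close>

definition is_polynomial_algebra :: "('k::field \<Rightarrow> 'a) \<Rightarrow> 'a ring \<Rightarrow> bool" where
  "is_polynomial_algebra \<iota> R \<longleftrightarrow>
     (\<exists>m::nat. \<exists>h \<in> ring_iso (poly_ring {..<m} :: (nat, 'k) mpolynomial ring) R.
        \<forall>c. h (const_poly c) = \<iota> c)"

end

theory Submission
  imports Defs "HOL-Computational_Algebra.Polynomial"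
begin

text \<open>
  In the coordinates \<open>x\<^sub>1, \<dots>, x\<^sub>n\<close> the generators of \<open>G\<close> act by block substitutions. Let \<open>R\<close> be the ring
  of polynomials in the variables up to the end of a block \<open>Y\<close>, and \<open>U\<close> the set of variables before \<open>Y\<close>.
  Every generator commutes on \<open>R\<close> with the translations \<open>y \<mapsto> y + t\<close> for \<open>y \<in> Y\<close>, so \<open>R\<^sup>G\<close> is closed under
  the Hasse derivatives in the variables of \<open>Y\<close>. Order monomials lexicographically and look at smallest
  (trailing) monomials. If \<open>f \<in> R\<^sup>G\<close> has a trailing monomial \<open>y\<^sup>a\<close> without variables from \<open>U\<close>, then Hasse
  derivatives of \<open>f\<close> have trailing monomials \<open>y\<^sub>j\<^sup>r\<close> for all \<open>r\<close> with \<open>a\<^sub>j choose r \<noteq> 0\<close> in the field. Let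
  \<open>q\<^sub>j\<close> be the least positive exponent such that \<open>y\<^sub>j\<close> to that power is the trailing monomial of a homogeneous
  \<open>f\<^sub>j \<in> R\<^sup>G\<close>. Minimality makes all \<open>q\<^sub>j choose i\<close> with \<open>0 < i < q\<^sub>j\<close> vanish, and it follows that \<open>q\<^sub>j\<close>
  divides \<open>a\<^sub>j\<close>. So a product of the \<open>f\<^sub>j\<close> has the same trailing monomial as \<open>f\<close> and can be subtracted.
  When every monomial of \<open>f\<close> involves \<open>U\<close>, the coefficients of \<open>f\<close> with respect to \<open>Y\<close> are invariants
  of positive degree in the earlier variables. By induction over the blocks the \<open>f\<^sub>j\<close> generate the Hilbert
  ideal. A splitting of \<open>S\<^sup>G \<subseteq> S\<close> turns ideal generators into algebra generators, and the \<open>f\<^sub>j\<close> are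
  algebraically independent since their trailing monomials are powers of distinct variables.
\<close>

abbreviation "lookup \<equiv> Poly_Mapping.lookup"
abbreviation "keys \<equiv> Poly_Mapping.keys"
abbreviation "single \<equiv> Poly_Mapping.single"

section \<open>Evaluation homomorphisms\<close>

text \<open>Unital homomorphisms of type-class rings. Evaluations, substitutions and expansions in
  an auxiliary variable are instances, so that their compatibility can be checked on
  generators.\<close>

locale ring_map =
  fixes h :: "'a::comm_ring_1 \<Rightarrow> 'b::comm_ring_1"
  assumes map_one: "h 1 = 1"
    and map_add: "h (a + b) = h a + h b"
    and map_mult: "h (a * b) = h a * h b"
begin

lemma map_zero: "h 0 = 0"
  using map_add[of 0 0] by simp

lemma map_uminus: "h (- a) = - h a"
  using map_add[of a "- a"] map_zero by (simp add: eq_neg_iff_add_eq_0 add.commute)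

lemma map_diff: "h (a - b) = h a - h b"
  using map_add[of a "- b"] map_uminus by simp

lemma map_power: "h (a ^ n) = h a ^ n"
  by (induction n) (simp_all add: map_one map_mult)

lemma map_sum: "h (sum f A) = (\<Sum>a\<in>A. h (f a))"
  by (induction A rule: infinite_finite_induct) (simp_all add: map_zero map_add)

lemma map_prod: "h (prod f A) = (\<Prod>a\<in>A. h (f a))"
  by (induction A rule: infinite_finite_induct) (simp_all add: map_one map_mult)

end

definition monom_eval :: "('w \<Rightarrow> 'a::comm_ring_1) \<Rightarrow> ('w \<Rightarrow>\<^sub>0 nat) \<Rightarrow> 'a" where
  "monom_eval \<phi> m = (\<Prod>w\<in>keys m. \<phi> w ^ lookup m w)"

text \<open>The coefficient map \<open>\<iota>\<close> is a parameter because values are taken both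
  in polynomial rings (\<open>subst\<close>) and in univariate polynomials over them
  (\<open>expand\<close>).\<close>

definition poly_eval :: "('k::field \<Rightarrow> 'a::comm_ring_1) \<Rightarrow> ('w \<Rightarrow> 'a) \<Rightarrow> ('w, 'k) mpolynomial \<Rightarrow> 'a" where
  "poly_eval \<iota> \<phi> p = (\<Sum>m\<in>keys p. \<iota> (lookup p m) * monom_eval \<phi> m)"

lemma monom_eval_superset:
  assumes "finite A" "keys m \<subseteq> A"
  shows "monom_eval \<phi> m = (\<Prod>w\<in>A. \<phi> w ^ lookup m w)"
  unfolding monom_eval_def using assms
  by (intro prod.mono_neutral_left) (auto simp: in_keys_iff)

lemma monom_eval_0 [simp]: "monom_eval \<phi> 0 = 1"
  by (simp add: monom_eval_def)

lemma monom_eval_add: "monom_eval \<phi> (m + m') = monom_eval \<phi> m * monom_eval \<phi> m'"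
proof -
  let ?A = "keys m \<union> keys m'"
  have "monom_eval \<phi> (m + m') = (\<Prod>w\<in>?A. \<phi> w ^ lookup (m + m') w)"
    using Poly_Mapping.keys_add[of m m'] by (intro monom_eval_superset) auto
  also have "\<dots> = (\<Prod>w\<in>?A. \<phi> w ^ lookup m w) * (\<Prod>w\<in>?A. \<phi> w ^ lookup m' w)"
    by (simp add: lookup_add power_add prod.distrib)
  also have "\<dots> = monom_eval \<phi> m * monom_eval \<phi> m'"
    by (simp add: monom_eval_superset[of ?A])
  finally show ?thesis .
qed

lemma monom_eval_single [simp]: "monom_eval \<phi> (single w n) = \<phi> w ^ n"
  by (cases "n = 0") (simp_all add: monom_eval_def)

lemma monom_eval_cong: "(\<And>w. w \<in> keys m \<Longrightarrow> \<phi> w = \<psi> w) \<Longrightarrow> monom_eval \<phi> m = monom_eval \<psi> m"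
  by (simp add: monom_eval_def)

lemma (in ring_map) map_monom_eval: "h (monom_eval \<phi> m) = monom_eval (\<lambda>w. h (\<phi> w)) m"
  by (simp add: monom_eval_def map_prod map_power)

lemma indet_power: "indet w ^ n = (single (single w n) 1 :: ('w, 'k::field) mpolynomial)"
proof (induction n)
  case (Suc n)
  then show ?case by (simp add: indet_def mult_single single_add[symmetric])
qed simp

lemma monom_eval_indet: "monom_eval indet m = (single m 1 :: ('w, 'k::field) mpolynomial)"
proof (induction m rule: update_induct)
  case const
  then show ?case by simp
next
  case (update f a b)
  have "Poly_Mapping.update a b f = f + single a b"
    using update(1) by (intro poly_mapping_eqI)
      (auto simp: lookup_update lookup_add lookup_single in_keys_iff when_def)
  then show ?case
    using update by (simp add: monom_eval_add indet_power mult_single)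
qed

lemma single_eq_const_mult: "single m c = const_poly c * monom_eval indet m"
  by (simp add: monom_eval_indet const_poly_def mult_single)

lemma poly_mapping_sum_single: "p = (\<Sum>m\<in>keys p. single m (lookup p m))"
  by (rule poly_mapping_eqI) (auto simp: lookup_sum lookup_single when_def in_keys_iff)

lemma poly_eval_superset:
  assumes "finite A" "keys p \<subseteq> A" "\<iota> 0 = 0"
  shows "poly_eval \<iota> \<phi> p = (\<Sum>m\<in>A. \<iota> (lookup p m) * monom_eval \<phi> m)"
  unfolding poly_eval_def using assms
  by (intro sum.mono_neutral_left) (auto simp: in_keys_iff)

lemma poly_eval_single: "\<iota> 0 = 0 \<Longrightarrow> poly_eval \<iota> \<phi> (single m c) = \<iota> c * monom_eval \<phi> m"
  by (cases "c = 0") (simp_all add: poly_eval_def)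

lemma poly_eval_add:
  assumes "ring_map \<iota>"
  shows "poly_eval \<iota> \<phi> (p + q) = poly_eval \<iota> \<phi> p + poly_eval \<iota> \<phi> q"
proof -
  interpret ring_map \<iota> by fact
  let ?A = "keys p \<union> keys q"
  have "poly_eval \<iota> \<phi> (p + q) = (\<Sum>m\<in>?A. \<iota> (lookup (p + q) m) * monom_eval \<phi> m)"
    using Poly_Mapping.keys_add[of p q] by (intro poly_eval_superset) (auto simp: map_zero)
  also have "\<dots> = (\<Sum>m\<in>?A. \<iota> (lookup p m) * monom_eval \<phi> m) + (\<Sum>m\<in>?A. \<iota> (lookup q m) * monom_eval \<phi> m)"
    by (simp add: lookup_add map_add distrib_right sum.distrib)
  also have "\<dots> = poly_eval \<iota> \<phi> p + poly_eval \<iota> \<phi> q"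
    by (simp add: poly_eval_superset[of ?A] map_zero)
  finally show ?thesis .
qed

lemma poly_eval_0 [simp]: "poly_eval \<iota> \<phi> 0 = 0"
  by (simp add: poly_eval_def)

lemma poly_eval_sum:
  assumes "ring_map \<iota>"
  shows "poly_eval \<iota> \<phi> (sum f A) = (\<Sum>a\<in>A. poly_eval \<iota> \<phi> (f a))"
  by (induction A rule: infinite_finite_induct) (simp_all add: poly_eval_add[OF assms])

lemma ring_map_poly_eval:
  fixes \<iota> :: "'k::field \<Rightarrow> 'a::comm_ring_1" and \<phi> :: "'w \<Rightarrow> 'a"
  assumes "ring_map \<iota>"
  shows "ring_map (poly_eval \<iota> \<phi>)"
proof
  interpret ring_map \<iota> by fact
  note s = poly_eval_single[of \<iota>, OF map_zero]
  show "poly_eval \<iota> \<phi> 1 = 1"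
    using s[of \<phi> 0 1] by (simp add: map_one)
  show "poly_eval \<iota> \<phi> (p + q) = poly_eval \<iota> \<phi> p + poly_eval \<iota> \<phi> q" for p q
    by (rule poly_eval_add[OF assms])
  fix p q :: "('w, 'k) mpolynomial"
  have "p * q = (\<Sum>m\<in>keys p. \<Sum>m'\<in>keys q. single (m + m') (lookup p m * lookup q m'))"
    using arg_cong2[of _ _ _ _ times, OF poly_mapping_sum_single[of p] poly_mapping_sum_single[of q]]
    by (simp only: sum_product mult_single)
  also have "poly_eval \<iota> \<phi> \<dots> = poly_eval \<iota> \<phi> p * poly_eval \<iota> \<phi> q"
    by (simp add: poly_eval_sum[OF assms] s map_mult monom_eval_add poly_eval_def[of _ _ p]
        poly_eval_def[of _ _ q] sum_product mult_ac)
  finally show "poly_eval \<iota> \<phi> (p * q) = poly_eval \<iota> \<phi> p * poly_eval \<iota> \<phi> q" .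
qed

lemma ring_map_const_poly: "ring_map const_poly"
  by unfold_locales (simp_all add: const_poly_def single_add mult_single)

lemma poly_eval_const: "\<iota> 0 = 0 \<Longrightarrow> poly_eval \<iota> \<phi> (const_poly c) = \<iota> c"
  by (simp add: const_poly_def poly_eval_single)

lemma poly_eval_indet: "ring_map \<iota> \<Longrightarrow> poly_eval \<iota> \<phi> (indet w) = \<phi> w"
  by (simp add: indet_def poly_eval_single ring_map.map_zero ring_map.map_one)

abbreviation subst :: "('w \<Rightarrow> ('v, 'k::field) mpolynomial) \<Rightarrow> ('w, 'k) mpolynomial \<Rightarrow> ('v, 'k) mpolynomial" where
  "subst \<equiv> poly_eval const_poly"

lemma ring_map_subst: "ring_map (subst \<phi>)"
  by (rule ring_map_poly_eval[OF ring_map_const_poly])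

lemma subst_const [simp]: "subst \<phi> (const_poly c) = const_poly c"
  by (simp add: poly_eval_const ring_map.map_zero[OF ring_map_const_poly])

lemma subst_indet [simp]: "subst \<phi> (indet w) = \<phi> w"
  by (simp add: poly_eval_indet ring_map_const_poly)

lemma rename_vars_eq_subst: "rename_vars f = subst (\<lambda>w. indet (f w))"
  by (rule ext) (simp add: rename_vars_def poly_eval_def monom_eval_def)

section \<open>Polynomials in a given set of variables\<close>

text \<open>The carrier of \<open>poly_ring W\<close> as a plain set, so that membership can be
  combined with type-class arithmetic.\<close>

definition polys :: "'w set \<Rightarrow> ('w, 'k::field) mpolynomial set" where
  "polys W = {p. \<forall>m\<in>keys p. keys m \<subseteq> W}"

lemma polysD: "p \<in> polys W \<Longrightarrow> m \<in> keys p \<Longrightarrow> keys m \<subseteq> W"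
  by (auto simp: polys_def)

lemma polys_mono: "W \<subseteq> W' \<Longrightarrow> polys W \<subseteq> polys W'"
  by (auto simp: polys_def)

lemma polys_0 [simp]: "0 \<in> polys W"
  by (simp add: polys_def)

lemma polys_single: "keys m \<subseteq> W \<Longrightarrow> single m c \<in> polys W"
  by (simp add: polys_def)

lemma polys_const [simp]: "const_poly c \<in> polys W"
  by (simp add: const_poly_def polys_single)

lemma polys_1 [simp]: "1 \<in> polys W"
  using polys_const[of 1 W] by (simp add: const_poly_def)

lemma polys_indet: "w \<in> W \<Longrightarrow> indet w \<in> polys W"
  by (simp add: indet_def polys_single)

lemma polys_add: "p \<in> polys W \<Longrightarrow> q \<in> polys W \<Longrightarrow> p + q \<in> polys W"
  using Poly_Mapping.keys_add[of p q] by (auto simp: polys_def)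

lemma polys_uminus: "p \<in> polys W \<Longrightarrow> - p \<in> polys W"
  by (simp add: polys_def in_keys_iff)

lemma polys_diff: "p \<in> polys W \<Longrightarrow> q \<in> polys W \<Longrightarrow> p - q \<in> polys W"
  using polys_add[of p W "- q"] polys_uminus[of q W] by simp

lemma polys_mult:
  assumes "p \<in> polys W" "q \<in> polys W"
  shows "p * q \<in> polys W"
  unfolding polys_def
proof safe
  fix m w assume "m \<in> keys (p * q)" "w \<in> keys m"
  then obtain a b where "m = a + b" "a \<in> keys p" "b \<in> keys q"
    using Poly_Mapping.keys_mult[of p q] by blast
  then show "w \<in> W"
    using \<open>w \<in> keys m\<close> Poly_Mapping.keys_add[of a b] polysD[OF assms(1)] polysD[OF assms(2)] by blast
qed

lemma polys_power: "p \<in> polys W \<Longrightarrow> p ^ n \<in> polys W"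
  by (induction n) (simp_all add: polys_mult)

lemma polys_sum: "(\<And>a. a \<in> A \<Longrightarrow> f a \<in> polys W) \<Longrightarrow> sum f A \<in> polys W"
  by (induction A rule: infinite_finite_induct) (simp_all add: polys_add)

lemma polys_prod: "(\<And>a. a \<in> A \<Longrightarrow> f a \<in> polys W) \<Longrightarrow> prod f A \<in> polys W"
  by (induction A rule: infinite_finite_induct) (simp_all add: polys_mult)

lemma polys_subst:
  assumes "p \<in> polys W" "\<And>w. w \<in> W \<Longrightarrow> \<phi> w \<in> polys V"
  shows "subst \<phi> p \<in> polys V"
  unfolding poly_eval_def monom_eval_def
  using assms by (intro polys_sum polys_mult polys_const polys_prod polys_power) (auto dest: polysD)

text \<open>The uniqueness half of the universal property of polynomial rings: both maps agree on
  monomials, hence on their sums. Identities between substitutions reduce in this way to a check on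
  the variables.\<close>

lemma ring_map_eqI:
  assumes "ring_map h" "ring_map h'"
    and "\<And>c. h (const_poly c) = h' (const_poly c)"
    and "\<And>w. w \<in> W \<Longrightarrow> h (indet w) = h' (indet w)"
    and "p \<in> polys W"
  shows "h p = h' p"
proof -
  interpret h: ring_map h by fact
  interpret h': ring_map h' by fact
  have eq: "h (single m c) = h' (single m c)" if "keys m \<subseteq> W" for m c
    using monom_eval_cong[of m "\<lambda>w. h (indet w)" "\<lambda>w. h' (indet w)"] that assms(3,4)
    by (simp add: single_eq_const_mult h.map_mult h'.map_mult h.map_monom_eval h'.map_monom_eval
        subset_iff)
  have "h p = (\<Sum>m\<in>keys p. h (single m (lookup p m)))"
    using arg_cong[of _ _ h, OF poly_mapping_sum_single[of p]] by (simp only: h.map_sum)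
  also have "\<dots> = (\<Sum>m\<in>keys p. h' (single m (lookup p m)))"
    using assms(5) by (intro sum.cong refl eq) (auto simp: polys_def)
  also have "\<dots> = h' p"
    using arg_cong[of _ _ h', OF poly_mapping_sum_single[of p]] by (simp only: h'.map_sum)
  finally show ?thesis .
qed

lemma ring_map_comp: "ring_map g \<Longrightarrow> ring_map h \<Longrightarrow> ring_map (\<lambda>x. g (h x))"
  by (simp add: ring_map_def)

lemma ring_map_ident: "ring_map (\<lambda>x. x)"
  by (simp add: ring_map_def)

lemma subst_subst: "subst \<psi> (subst \<phi> p) = subst (\<lambda>w. subst \<psi> (\<phi> w)) p"
  by (rule ring_map_eqI[of "\<lambda>p. subst \<psi> (subst \<phi> p)" _ UNIV])
    (auto intro: ring_map_comp ring_map_subst simp: polys_def)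

lemma subst_cong: "p \<in> polys W \<Longrightarrow> (\<And>w. w \<in> W \<Longrightarrow> \<phi> w = \<psi> w) \<Longrightarrow> subst \<phi> p = subst \<psi> p"
  by (rule ring_map_eqI[of "subst \<phi>" _ W]) (auto intro: ring_map_subst)

lemma subst_indet_ident: "p \<in> polys W \<Longrightarrow> (\<And>w. w \<in> W \<Longrightarrow> \<phi> w = indet w) \<Longrightarrow> subst \<phi> p = p"
  by (rule ring_map_eqI[of "subst \<phi>" _ W]) (auto intro: ring_map_subst ring_map_ident)

section \<open>Degrees and trailing monomials\<close>

definition mdeg :: "('w \<Rightarrow>\<^sub>0 nat) \<Rightarrow> nat" where
  "mdeg m = (\<Sum>i\<in>keys m. lookup m i)"

lemma mdeg_superset: "finite A \<Longrightarrow> keys m \<subseteq> A \<Longrightarrow> mdeg m = (\<Sum>i\<in>A. lookup m i)"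
  unfolding mdeg_def by (intro sum.mono_neutral_left) (auto simp: in_keys_iff)

lemma mdeg_add: "mdeg (m + m') = mdeg m + mdeg m'"
  using Poly_Mapping.keys_add[of m m']
  by (simp add: mdeg_superset[of "keys m \<union> keys m'"] lookup_add sum.distrib)

lemma mdeg_0 [simp]: "mdeg 0 = 0"
  by (simp add: mdeg_def)

lemma mdeg_single [simp]: "mdeg (single i n) = n"
  by (cases "n = 0") (simp_all add: mdeg_def)

lemma mdeg_eq_0_iff: "mdeg m = 0 \<longleftrightarrow> m = 0"
  by (auto simp: mdeg_def in_keys_iff intro!: poly_mapping_eqI)

definition homogeneous :: "nat \<Rightarrow> ('w, 'k::field) mpolynomial \<Rightarrow> bool" where
  "homogeneous d p \<longleftrightarrow> (\<forall>m\<in>keys p. mdeg m = d)"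

lemma homogeneous_0 [simp]: "homogeneous d 0"
  by (simp add: homogeneous_def)

lemma homogeneous_single: "mdeg m = d \<Longrightarrow> homogeneous d (single m c)"
  by (simp add: homogeneous_def)

lemma homogeneous_1 [simp]: "homogeneous 0 1"
  by (simp add: homogeneous_def)

lemma homogeneous_add: "homogeneous d p \<Longrightarrow> homogeneous d q \<Longrightarrow> homogeneous d (p + q)"
  using Poly_Mapping.keys_add[of p q] by (auto simp: homogeneous_def)

lemma homogeneous_mult:
  assumes "homogeneous d p" "homogeneous e q"
  shows "homogeneous (d + e) (p * q)"
  unfolding homogeneous_def
proof
  fix m assume "m \<in> keys (p * q)"
  then obtain a b where "m = a + b" "a \<in> keys p" "b \<in> keys q"
    using Poly_Mapping.keys_mult[of p q] by blast
  then show "mdeg m = d + e"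
    using assms by (simp add: homogeneous_def mdeg_add)
qed

lemma homogeneous_power: "homogeneous d p \<Longrightarrow> homogeneous (k * d) (p ^ k)"
  by (induction k) (simp_all add: homogeneous_mult)

lemma homogeneous_prod:
  "(\<And>a. a \<in> A \<Longrightarrow> homogeneous (d a) (f a)) \<Longrightarrow> homogeneous (sum d A) (prod f A)"
  by (induction A rule: infinite_finite_induct) (simp_all add: homogeneous_mult)

text \<open>The order on exponent vectors is lexicographic with the smallest index weighing most. A
  monomial free of the early variables is therefore below every monomial that involves one of
  them.\<close>

definition trailing :: "(nat, 'k::field) mpolynomial \<Rightarrow> (nat \<Rightarrow>\<^sub>0 nat) \<Rightarrow> bool" where
  "trailing p a \<longleftrightarrow> a \<in> keys p \<and> (\<forall>m\<in>keys p. a \<le> m)"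

lemma trailing_exists: "p \<noteq> 0 \<Longrightarrow> \<exists>a. trailing p a"
  unfolding trailing_def by (rule exI[of _ "Min (keys p)"]) auto

lemma trailing_lookup: "trailing p a \<Longrightarrow> lookup p a \<noteq> 0"
  by (simp add: trailing_def in_keys_iff)

text \<open>The order is compatible with addition, so \<open>a + b = l + k\<close> with
  \<open>a \<le> l\<close> and \<open>b \<le> k\<close> forces \<open>l = a\<close> and
  \<open>k = b\<close>. A single term of the convolution survives, and it is nonzero over a
  field.\<close>

lemma trailing_mult:
  assumes "trailing p a" "trailing q b"
  shows "trailing (p * q) (a + b)" and "lookup (p * q) (a + b) = lookup p a * lookup q b"
proof -
  have eq: "lookup p l * (\<Sum>k. lookup q k when a + b = l + k) =
    (lookup p a * lookup q b when l = a)" for l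
  proof (cases "l \<in> keys p")
    case True
    have "a + b = l + k \<longleftrightarrow> l = a \<and> k = b" if "k \<in> keys q" for k
      using True that assms add_less_le_mono[of a l b k] add_le_less_mono[of a l b k]
      by (auto simp: trailing_def order_le_less)
    then have "(\<Sum>k. lookup q k when a + b = l + k) = (\<Sum>k. (lookup q b when l = a) when k = b)"
      by (intro Sum_any.cong) (auto simp: when_def in_keys_iff)
    then show ?thesis by (simp add: when_def)
  qed (use assms in \<open>auto simp: in_keys_iff trailing_def when_def\<close>)
  show l: "lookup (p * q) (a + b) = lookup p a * lookup q b"
    by (simp add: lookup_mult eq)
  show "trailing (p * q) (a + b)"
    unfolding trailing_def
  proof
    show "a + b \<in> keys (p * q)"
      using l assms by (simp add: in_keys_iff trailing_def)
    show "\<forall>m\<in>keys (p * q). a + b \<le> m"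
      using Poly_Mapping.keys_mult[of p q] assms by (fastforce simp: trailing_def intro: add_mono)
  qed
qed

lemma trailing_1: "trailing 1 0"
  by (simp add: trailing_def)

lemma trailing_power:
  assumes "trailing p (single i q)"
  shows "trailing (p ^ k) (single i (k * q))"
proof (induction k)
  case (Suc k)
  then show ?case
    using trailing_mult(1)[OF assms Suc] by (simp add: single_add[symmetric])
qed (simp add: trailing_1)

lemma trailing_prod:
  "(\<And>i. i \<in> A \<Longrightarrow> trailing (f i) (a i)) \<Longrightarrow> trailing (prod f A) (sum a A)"
  by (induction A rule: infinite_finite_induct) (simp_all add: trailing_1 trailing_mult)

section \<open>Coefficients with respect to an auxiliary variable\<close>

lemma ring_map_pCons: "ring_map (\<lambda>a. [:a:])"
  by unfold_locales (simp_all add: one_pCons)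

lemma ring_map_const_pCons: "ring_map (\<lambda>c. [:const_poly c:])"
  by (rule ring_map_comp[OF ring_map_pCons ring_map_const_poly])

lemma ring_map_map_poly:
  assumes "ring_map h"
  shows "ring_map (map_poly h)"
proof -
  interpret ring_map h by fact
  note [simp] = coeff_map_poly[of h, OF map_zero]
  show ?thesis
    by unfold_locales (auto intro!: poly_eqI simp: map_one map_add map_mult map_sum coeff_mult)
qed

text \<open>The values are polynomials in an auxiliary variable \<open>t\<close> with polynomial
  coefficients. The choice of \<open>\<omega>\<close> decides what the coefficient of a power of
  \<open>t\<close> means; see \<open>hcomp\<close>, \<open>hasse\<close> and
  \<open>vcoeff\<close>.\<close>

definition expand ::
  "(nat \<Rightarrow> (nat, 'k::field) mpolynomial poly) \<Rightarrow> (nat, 'k) mpolynomial \<Rightarrow> (nat, 'k) mpolynomial poly" where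
  "expand \<omega> = poly_eval (\<lambda>c. [:const_poly c:]) \<omega>"

lemma ring_map_expand: "ring_map (expand \<omega>)"
  unfolding expand_def by (rule ring_map_poly_eval[OF ring_map_const_pCons])

lemma expand_const: "expand \<omega> (const_poly c) = [:const_poly c:]"
  unfolding expand_def by (rule poly_eval_const) (simp add: const_poly_def)

lemma expand_indet: "expand \<omega> (indet i) = \<omega> i"
  unfolding expand_def by (rule poly_eval_indet[OF ring_map_const_pCons])

lemma lookup_coeff_expand:
  "lookup (poly.coeff (expand \<omega> p) s) m =
    (\<Sum>k\<in>keys p. lookup (const_poly (lookup p k) * poly.coeff (monom_eval \<omega> k) s) m)"
  by (simp add: expand_def poly_eval_def coeff_sum lookup_sum)

lemma monom_eval_pCons: "monom_eval (\<lambda>i. [:\<phi> i:]) m = [:monom_eval \<phi> m:]"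
  by (rule ring_map.map_monom_eval[OF ring_map_pCons, symmetric])

text \<open>If \<open>\<sigma>\<close> is compatible with \<open>\<omega>\<close> on the variables,
  then expanding \<open>\<sigma> p\<close> amounts to applying \<open>\<sigma>\<close> to the
  coefficients of the expansion of \<open>p\<close>. Hence an invariant has invariant coefficients.
  This one criterion serves homogeneous components, Hasse derivatives and coefficients in a
  variable.\<close>

lemma expand_invariant:
  assumes "ring_map \<sigma>" "\<And>c. \<sigma> (const_poly c) = const_poly c"
    and "\<And>i. i \<in> W \<Longrightarrow> expand \<omega> (\<sigma> (indet i)) = map_poly \<sigma> (\<omega> i)"
    and "p \<in> polys W" "\<sigma> p = p"
  shows "\<sigma> (poly.coeff (expand \<omega> p) s) = poly.coeff (expand \<omega> p) s"
proof -
  have z: "\<sigma> 0 = 0" by (rule ring_map.map_zero[OF assms(1)])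
  have "expand \<omega> (\<sigma> p) = map_poly \<sigma> (expand \<omega> p)"
    by (rule ring_map_eqI[where W = W, OF ring_map_comp[OF ring_map_expand assms(1)]
          ring_map_comp[OF ring_map_map_poly[OF assms(1)] ring_map_expand]])
      (simp_all add: assms expand_const expand_indet map_poly_pCons z)
  then show ?thesis
    using assms(5) coeff_map_poly[of \<sigma>, OF z, of "expand \<omega> p" s] by simp
qed

lemma coeff_monic_linear_power:
  "poly.coeff ([:a, 1:] ^ k) s = of_nat (k choose s) * (a :: 'a::comm_ring_1) ^ (k - s)"
proof (cases "s \<le> k")
  case False
  have "degree ([:a, 1:] ^ k) \<le> k"
    using degree_power_le[of "[:a, 1:]" k] by simp
  then show ?thesis
    using False by (simp add: coeff_eq_0 binomial_eq_0)
qed (simp add: coeff_linear_poly_power)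

text \<open>Replacing each variable \<open>x\<^sub>i\<close> by \<open>t x\<^sub>i\<close>
  multiplies a monomial by \<open>t\<close> to its degree, so this is the homogeneous component of
  degree \<open>d\<close>.\<close>

definition hcomp :: "nat \<Rightarrow> (nat, 'k::field) mpolynomial \<Rightarrow> (nat, 'k) mpolynomial" where
  "hcomp d p = poly.coeff (expand (\<lambda>i. [:0, indet i:]) p) d"

lemma lookup_hcomp:
  fixes p :: "(nat, 'k::field) mpolynomial"
  shows "lookup (hcomp d p) m = (if mdeg m = d then lookup p m else 0)"
proof -
  have "monom_eval (\<lambda>i. [:0, indet i:]) k = Polynomial.monom (single k (1::'k)) (mdeg k)" for k :: "nat \<Rightarrow>\<^sub>0 nat"
  proof -
    have "[:0, indet i:] = (Polynomial.monom (indet i) 1 :: (nat, 'k) mpolynomial poly)" for i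
      by (simp add: monom_altdef)
    then have "monom_eval (\<lambda>i. [:0, indet i:]) k
        = (\<Prod>i\<in>keys k. Polynomial.monom (indet i ^ lookup k i :: (nat, 'k) mpolynomial) (lookup k i))"
      by (simp add: monom_eval_def monom_power)
    also have "\<dots> = Polynomial.monom (\<Prod>i\<in>keys k. indet i ^ lookup k i) (mdeg k)"
    proof -
      have "(\<Prod>i\<in>A. Polynomial.monom (f i) (g i)) = Polynomial.monom (\<Prod>i\<in>A. f i) (\<Sum>i\<in>A. g i)"
        if "finite A" for f :: "nat \<Rightarrow> (nat, 'k) mpolynomial" and g A
        using that by (induction A rule: finite_induct) (simp_all add: mult_monom)
      then show ?thesis by (simp add: mdeg_def)
    qed
    finally show ?thesis
      by (simp add: monom_eval_indet[symmetric] monom_eval_def[of _ k])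
  qed
  then have "lookup (hcomp d p) m = (\<Sum>k\<in>keys p. if k = m then (if mdeg k = d then lookup p k else 0) else 0)"
    unfolding hcomp_def lookup_coeff_expand
    by (intro sum.cong) (auto simp: const_poly_def mult_single lookup_single)
  then show ?thesis
    by (auto simp: in_keys_iff)
qed

text \<open>Variable \<open>j\<close> is translated by \<open>t\<close>. The coefficient is the
  Hasse derivative, which stands for the \<open>s\<close>-th derivative divided by the factorial of
  \<open>s\<close> and makes sense in every characteristic.\<close>

definition hasse :: "nat \<Rightarrow> nat \<Rightarrow> (nat, 'k::field) mpolynomial \<Rightarrow> (nat, 'k) mpolynomial" where
  "hasse j s p = poly.coeff (expand (\<lambda>i. if i = j then [:indet j, 1:] else [:indet i:]) p) s"

text \<open>With variable \<open>j\<close> itself replaced by \<open>t\<close>, the coefficients are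
  those of \<open>p\<close> as a polynomial in that variable.\<close>

definition vcoeff :: "nat \<Rightarrow> nat \<Rightarrow> (nat, 'k::field) mpolynomial \<Rightarrow> (nat, 'k) mpolynomial" where
  "vcoeff j s p = poly.coeff (expand (\<lambda>i. if i = j then [:0, 1:] else [:indet i:]) p) s"

lemma exponent_split:
  fixes k :: "'w \<Rightarrow>\<^sub>0 nat"
  obtains k' where "k = k' + single j (lookup k j)" "lookup k' j = 0"
proof
  show "k = (k - single j (lookup k j)) + single j (lookup k j)"
    by (rule poly_mapping_eqI) (simp add: lookup_add lookup_minus lookup_single when_def)
qed (simp add: lookup_minus)

text \<open>One binomial expansion for two operators: \<open>a = indet j\<close> gives
  \<open>hasse\<close> and \<open>a = 0\<close> gives \<open>vcoeff\<close>.\<close>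

lemma monom_eval_linear:
  fixes a :: "(nat, 'k::field) mpolynomial"
  shows "poly.coeff (monom_eval (\<lambda>i. if i = j then [:a, 1:] else [:indet i:]) k) s =
    of_nat (lookup k j choose s) * (a ^ (lookup k j - s) * single (k - single j (lookup k j)) 1)"
proof -
  obtain k' where k': "k = k' + single j (lookup k j)" "lookup k' j = 0"
    by (rule exponent_split)
  have "monom_eval (\<lambda>i. if i = j then [:a, 1:] else [:indet i:]) k' = monom_eval (\<lambda>i. [:indet i:]) k'"
    using k'(2) by (intro monom_eval_cong) (auto simp: in_keys_iff)
  then have "monom_eval (\<lambda>i. if i = j then [:a, 1:] else [:indet i:]) k
      = [:single k' 1:] * [:a, 1:] ^ lookup k j"
    using arg_cong[OF k'(1), of "monom_eval (\<lambda>i. if i = j then [:a, 1:] else [:indet i:])"]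
    by (simp add: monom_eval_add monom_eval_pCons monom_eval_indet)
  moreover have "k - single j (lookup k j) = k'"
    using arg_cong[OF k'(1), of "\<lambda>x. x - single j (lookup k j)"] by simp
  ultimately show ?thesis
    by (simp add: coeff_monic_linear_power mult_ac)
qed

lemma lookup_hasse:
  fixes p :: "(nat, 'k::field) mpolynomial"
  shows "lookup (hasse j s p) m = of_nat ((lookup m j + s) choose s) * lookup p (m + single j s)"
proof -
  \<comment> \<open>The subtraction of exponents is truncated, but when \<open>s\<close> exceeds the
    exponent of \<open>j\<close> the binomial coefficient is zero.\<close>
  have "const_poly c * poly.coeff (monom_eval (\<lambda>i. if i = j then [:indet j, 1:] else [:indet i:]) k) s
      = single (k - single j s) (of_nat (lookup k j choose s) * c)" for c :: 'k and k
  proof (cases "s \<le> lookup k j")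
    case True
    have "k - single j (lookup k j) + single j (lookup k j - s) = k - single j s"
      by (rule poly_mapping_eqI) (use True in \<open>auto simp: lookup_add lookup_minus lookup_single when_def\<close>)
    then show ?thesis
      by (simp add: monom_eval_linear indet_power mult_single const_poly_def single_of_nat[symmetric]
          mult_ac del: single_of_nat)
  qed (simp add: monom_eval_linear binomial_eq_0)
  then have "lookup (hasse j s p) m
      = (\<Sum>k\<in>keys p. lookup (single (k - single j s) (of_nat (lookup k j choose s) * lookup p k)) m)"
    unfolding hasse_def lookup_coeff_expand by simp
  also have "\<dots> = (\<Sum>k\<in>keys p. if k = m + single j s
      then of_nat ((lookup m j + s) choose s) * lookup p (m + single j s) else 0)"
  proof (rule sum.cong)
    fix k
    have "k = (k - single j s) + single j s" if "s \<le> lookup k j"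
      by (rule poly_mapping_eqI) (use that in \<open>auto simp: lookup_add lookup_minus lookup_single when_def\<close>)
    then show "lookup (single (k - single j s) (of_nat (lookup k j choose s) * lookup p k)) m =
       (if k = m + single j s then of_nat ((lookup m j + s) choose s) * lookup p (m + single j s) else 0)"
      by (cases "s \<le> lookup k j") (auto simp: lookup_single when_def lookup_add binomial_eq_0 not_le)
  qed simp
  also have "\<dots> = of_nat ((lookup m j + s) choose s) * lookup p (m + single j s)"
    by (auto simp: in_keys_iff)
  finally show ?thesis .
qed

lemma lookup_vcoeff:
  fixes p :: "(nat, 'k::field) mpolynomial"
  shows "lookup (vcoeff j s p) m = (if lookup m j = 0 then lookup p (m + single j s) else 0)"
proof -
  \<comment> \<open>The binomial coefficient kills exponents below \<open>s\<close>, and the power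
    of \<open>0\<close> kills those above \<open>s\<close>.\<close>
  have *: "const_poly c * poly.coeff (monom_eval (\<lambda>i. if i = j then [:0, 1:] else [:indet i:]) k) s
      = (if lookup k j = s then single (k - single j s) c else 0)" for c :: 'k and k
    by (cases "s < lookup k j"; cases "s = lookup k j")
      (simp_all add: monom_eval_linear const_poly_def mult_single binomial_eq_0)
  have "lookup (vcoeff j s p) m
      = (\<Sum>k\<in>keys p. if lookup k j = s then lookup (single (k - single j s) (lookup p k)) m else 0)"
    unfolding vcoeff_def lookup_coeff_expand * by (intro sum.cong) auto
  also have "\<dots> = (\<Sum>k\<in>keys p. if k = m + single j s
      then (if lookup m j = 0 then lookup p (m + single j s) else 0) else 0)"
  proof (rule sum.cong)
    fix k
    have "k = (k - single j s) + single j s" if "lookup k j = s"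
      by (rule poly_mapping_eqI) (use that in \<open>auto simp: lookup_add lookup_minus lookup_single when_def\<close>)
    moreover have "lookup (k - single j s) j = 0" if "lookup k j = s"
      using that by (simp add: lookup_minus)
    ultimately show "(if lookup k j = s then lookup (single (k - single j s) (lookup p k)) m else 0) =
       (if k = m + single j s then (if lookup m j = 0 then lookup p (m + single j s) else 0) else 0)"
      by (auto simp: lookup_single when_def lookup_add)
  qed simp
  also have "\<dots> = (if lookup m j = 0 then lookup p (m + single j s) else 0)"
    by (auto simp: in_keys_iff)
  finally show ?thesis .
qed

lemma sum_hcomp: "p = (\<Sum>d\<in>mdeg ` keys p. hcomp d p)"
  by (rule poly_mapping_eqI) (auto simp: lookup_sum lookup_hcomp in_keys_iff)

text \<open>Setting \<open>t\<close> equal to variable \<open>j\<close> undoes the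
  expansion.\<close>

lemma vcoeff_expansion:
  fixes p :: "(nat, 'k::field) mpolynomial"
  shows "p = (\<Sum>s\<in>(\<lambda>m. lookup m j) ` keys p. vcoeff j s p * indet j ^ s)"
proof -
  have "ring_map (\<lambda>q. poly q (indet j :: (nat, 'k) mpolynomial))"
    by unfold_locales simp_all
  from ring_map_comp[OF this ring_map_expand]
  have "p = poly (expand (\<lambda>i. if i = j then [:0, 1:] else [:indet i:]) p) (indet j)"
    by (rule ring_map_eqI[where W = UNIV, OF ring_map_ident])
      (simp_all add: expand_const expand_indet polys_def)
  also have "\<dots> = (\<Sum>s\<in>(\<lambda>m. lookup m j) ` keys p. vcoeff j s p * indet j ^ s)"
  proof -
    have "vcoeff j s p = 0" if "s \<notin> (\<lambda>m. lookup m j) ` keys p" for s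
    proof (rule poly_mapping_eqI)
      fix m
      have "m + single j s \<notin> keys p" if "lookup m j = 0"
        using that \<open>s \<notin> _\<close> imageI[of "m + single j s" "keys p" "\<lambda>m. lookup m j"]
        by (auto simp: lookup_add)
      then show "lookup (vcoeff j s p) m = lookup 0 m"
        by (simp add: lookup_vcoeff in_keys_iff)
    qed
    then show ?thesis
      unfolding poly_altdef vcoeff_def
      by (intro sum.mono_neutral_cong) (auto simp: coeff_eq_0 not_le)
  qed
  finally show ?thesis .
qed

section \<open>Hasse derivatives and trailing monomials\<close>

lemma hcomp_homogeneous: "homogeneous d (hcomp d p)"
  by (auto simp: homogeneous_def in_keys_iff lookup_hcomp split: if_splits)

lemma hcomp_ident: "homogeneous d p \<Longrightarrow> hcomp e p = (if e = d then p else 0)"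
  by (rule poly_mapping_eqI) (auto simp: homogeneous_def in_keys_iff lookup_hcomp)

lemma hcomp_sum: "hcomp d (sum f A) = (\<Sum>a\<in>A. hcomp d (f a))"
  by (rule poly_mapping_eqI) (simp add: lookup_hcomp lookup_sum)

lemma hcomp_mult:
  assumes "homogeneous e q"
  shows "hcomp d (p * q) = (if e \<le> d then hcomp (d - e) p * q else 0)"
proof -
  have "hcomp d (hcomp c p * q) = (if c + e = d then hcomp c p * q else 0)" for c
    using hcomp_ident[OF homogeneous_mult[OF hcomp_homogeneous[of c p] assms], of d] by auto
  then have *: "hcomp d (p * q) = (\<Sum>c\<in>mdeg ` keys p. if c + e = d then hcomp c p * q else 0)"
    by (subst sum_hcomp[of p]) (simp add: sum_distrib_right hcomp_sum)
  show ?thesis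
  proof (cases "e \<le> d")
    case True
    have "hcomp (d - e) p = 0" if "d - e \<notin> mdeg ` keys p"
      using that by (intro poly_mapping_eqI) (force simp: lookup_hcomp in_keys_iff)
    moreover have "c + e = d \<longleftrightarrow> c = d - e" for c
      using True by auto
    ultimately show ?thesis
      using True by (simp add: *)
  qed (auto simp: * intro!: sum.neutral)
qed

lemma hcomp_polys: "p \<in> polys W \<Longrightarrow> hcomp d p \<in> polys W"
  by (auto simp: polys_def in_keys_iff lookup_hcomp split: if_splits)

lemma keys_subset_add: "keys (m :: 'w \<Rightarrow>\<^sub>0 nat) \<subseteq> keys (m + m')"
  by (auto simp: in_keys_iff lookup_add)

lemma keys_hasse: "m \<in> keys (hasse j s p) \<Longrightarrow> m + single j s \<in> keys p"
  by (auto simp: in_keys_iff lookup_hasse)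

lemma hasse_polys: "p \<in> polys W \<Longrightarrow> hasse j s p \<in> polys W"
  using keys_hasse keys_subset_add by (fastforce simp: polys_def)

lemma hasse_homogeneous: "homogeneous d p \<Longrightarrow> homogeneous (d - s) (hasse j s p)"
  by (auto simp: homogeneous_def mdeg_add dest!: keys_hasse)

text \<open>Every monomial of the derivative is a monomial of \<open>p\<close> lowered by
  \<open>single j s\<close>, and this shift preserves the order. The condition on the binomial
  coefficient keeps the trailing term alive.\<close>

lemma trailing_hasse:
  fixes p :: "(nat, 'k::field) mpolynomial"
  assumes "trailing p (a + single j s)" "of_nat ((lookup a j + s) choose s) \<noteq> (0::'k)"
  shows "trailing (hasse j s p) a"
  unfolding trailing_def
proof (intro conjI ballI)
  show "a \<in> keys (hasse j s p)"
    using assms by (simp add: in_keys_iff lookup_hasse trailing_def)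
  show "a \<le> m" if "m \<in> keys (hasse j s p)" for m
    using assms(1) keys_hasse[OF that] by (auto simp: trailing_def)
qed

lemma keys_vcoeff: "m \<in> keys (vcoeff j s p) \<Longrightarrow> m + single j s \<in> keys p \<and> lookup m j = 0"
  by (auto simp: in_keys_iff lookup_vcoeff split: if_splits)

lemma vcoeff_polys: "p \<in> polys (insert j W) \<Longrightarrow> vcoeff j s p \<in> polys W"
  unfolding polys_def
proof safe
  fix m w
  assume p: "\<forall>m\<in>keys p. keys m \<subseteq> insert j W" and m: "m \<in> keys (vcoeff j s p)" "w \<in> keys m"
  have "w \<in> insert j W"
    using p keys_vcoeff[OF m(1)] keys_subset_add[of m "single j s"] m(2) by blast
  moreover have "w \<noteq> j"
    using keys_vcoeff[OF m(1)] m(2) by (auto simp: in_keys_iff)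
  ultimately show "w \<in> W" by simp
qed

lemma expand_pCons:
  assumes "p \<in> polys W" "\<And>i. i \<in> W \<Longrightarrow> \<omega> i = [:indet i:]"
  shows "expand \<omega> p = [:p:]"
  by (rule ring_map_eqI[OF ring_map_expand ring_map_pCons _ _ assms(1)])
    (simp_all add: expand_const expand_indet assms(2))

text \<open>A linear form is its own component of degree 1, so it is multiplied by \<open>t\<close>.
  This makes linear substitutions compatible with the grading.\<close>

lemma expand_linear_form:
  assumes "homogeneous 1 p"
  shows "expand (\<lambda>i. [:0, indet i:]) p = [:0, p:]"
  using hcomp_ident[OF assms] by (intro poly_eqI)
    (simp add: hcomp_def coeff_pCons split: nat.split)

text \<open>The hypothesis says \<open>(1 + t)\<^sup>q = 1 + t\<^sup>q\<close>; in characteristic \<open>p\<close> this means that \<open>q\<close> is a power of \<open>p\<close>,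
  and the conclusion is then a case of Lucas' theorem.\<close>

lemma binomial_mod_power:
  assumes "0 < q" "\<And>i. 0 < i \<Longrightarrow> i < q \<Longrightarrow> of_nat (q choose i) = (0::'k::field)" "i < q"
  shows "of_nat ((u * q + r) choose i) = (of_nat (r choose i) :: 'k)"
proof -
  have "poly.coeff ([:1, 1:] ^ q) j = poly.coeff (1 + Polynomial.monom (1::'k) q) j" for j
    using assms(1) assms(2)[of j] by (cases "j = 0"; cases "j < q"; cases "j = q")
      (auto simp: coeff_monic_linear_power binomial_eq_0)
  then have q: "[:1, 1:] ^ q = 1 + Polynomial.monom (1::'k) q"
    by (intro poly_eqI)
  \<comment> \<open>A factor \<open>1 + t\<^sup>q\<close> leaves the coefficients below degree
    \<open>q\<close> unchanged, so \<open>u\<close> such factors can be stripped off.\<close>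
  have "poly.coeff ([:1, 1:] ^ (u * q + r)) i = poly.coeff ([:1, 1::'k:] ^ r) i"
  proof (induction u)
    case (Suc u)
    have "[:1, 1::'k:] ^ (Suc u * q + r) = [:1, 1:] ^ q * [:1, 1:] ^ (u * q + r)"
      by (simp add: power_add[symmetric] add_ac)
    then show ?case
      using Suc assms(3) by (simp add: q distrib_right coeff_monom_mult)
  qed simp
  then show ?thesis
    by (simp add: coeff_monic_linear_power)
qed

section \<open>Invariants of block substitutions\<close>

text \<open>Block \<open>l\<close> consists of the variables with index in
  \<open>{b l<..b (Suc l)}\<close> and may be empty. In the application a member of \<open>H\<close>
  lists the images of the variables under a group generator; it moves variables of one block only,
  adding linear forms in the variables before that block.\<close>

locale block_substitutions =
  fixes b :: "nat \<Rightarrow> nat" and N n :: nat and H :: "(nat \<Rightarrow> (nat, 'k::field) mpolynomial) set"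
  assumes b_0: "b 0 = 0" and b_mono: "\<And>l. l < N \<Longrightarrow> b l \<le> b (Suc l)" and b_N: "b N = n"
    and H_block: "\<And>\<phi>. \<phi> \<in> H \<Longrightarrow> \<exists>l<N. \<forall>i\<in>{1..n}. \<phi> i \<noteq> indet i \<longrightarrow>
      i \<in> {b l<..b (Suc l)} \<and> \<phi> i - indet i \<in> polys {1..b l} \<and> homogeneous 1 (\<phi> i - indet i)"
begin

definition invs :: "nat \<Rightarrow> (nat, 'k) mpolynomial set" where
  "invs l = {p \<in> polys {1..b l}. \<forall>\<phi>\<in>H. subst \<phi> p = p}"

lemma b_le: "l \<le> l' \<Longrightarrow> l' \<le> N \<Longrightarrow> b l \<le> b l'"
proof (induction l' rule: dec_induct)
  case (step k)
  then show ?case using b_mono[of k] by simp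
qed simp

lemma b_le_n: "l \<le> N \<Longrightarrow> b l \<le> n"
  using b_le[of l N] b_N by simp

lemma block_unique:
  assumes "j \<in> {b l<..b (Suc l)}" "j \<in> {b l'<..b (Suc l')}" "l < N" "l' < N"
  shows "l = l'"
proof (rule ccontr)
  assume "l \<noteq> l'"
  then consider "Suc l \<le> l'" | "Suc l' \<le> l" by linarith
  then show False
    using assms b_le[of "Suc l" l'] b_le[of "Suc l'" l] by cases auto
qed

lemma invs_polys: "p \<in> invs l \<Longrightarrow> l \<le> N \<Longrightarrow> p \<in> polys {1..n}"
  using polys_mono[of "{1..b l}" "{1..n}"] b_le_n[of l] by (auto simp: invs_def)

lemma invs_const: "const_poly c \<in> invs l"
  by (simp add: invs_def)

lemma invs_add: "p \<in> invs l \<Longrightarrow> q \<in> invs l \<Longrightarrow> p + q \<in> invs l"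
  by (simp add: invs_def polys_add ring_map.map_add[OF ring_map_subst])

lemma invs_diff: "p \<in> invs l \<Longrightarrow> q \<in> invs l \<Longrightarrow> p - q \<in> invs l"
  by (simp add: invs_def polys_diff ring_map.map_diff[OF ring_map_subst])

lemma invs_mult: "p \<in> invs l \<Longrightarrow> q \<in> invs l \<Longrightarrow> p * q \<in> invs l"
  by (simp add: invs_def polys_mult ring_map.map_mult[OF ring_map_subst])

lemma invs_1: "1 \<in> invs l"
  using invs_const[of 1] by (simp add: const_poly_def)

lemma invs_0: "0 \<in> invs l"
  using invs_const[of 0] by (simp add: const_poly_def)

lemma invs_power: "p \<in> invs l \<Longrightarrow> p ^ k \<in> invs l"
  by (induction k) (simp_all add: invs_1 invs_mult)

lemma invs_prod: "(\<And>a. a \<in> A \<Longrightarrow> f a \<in> invs l) \<Longrightarrow> prod f A \<in> invs l"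
  by (induction A rule: infinite_finite_induct) (simp_all add: invs_1 invs_mult)

lemma invs_sum: "(\<And>a. a \<in> A \<Longrightarrow> f a \<in> invs l) \<Longrightarrow> sum f A \<in> invs l"
  by (induction A rule: infinite_finite_induct) (simp_all add: invs_0 invs_add)

text \<open>If the block moved by \<open>\<phi>\<close> came after block \<open>l\<close>, then
  \<open>\<phi>\<close> would fix \<open>i\<close>; otherwise the forms it adds involve only
  variables before block \<open>l\<close>. The remainder \<open>d\<close> is thus free of the
  variables of block \<open>l\<close>.\<close>

lemma moved_part:
  assumes "\<phi> \<in> H" "l < N" "i \<in> {1..b (Suc l)}"
  obtains d where "\<phi> i = indet i + d" "d \<in> polys {1..b l}"
proof -
  have n: "i \<in> {1..n}" using assms b_le_n[of "Suc l"] by auto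
  obtain l' where l': "l' < N" "\<phi> i \<noteq> indet i \<longrightarrow>
      i \<in> {b l'<..b (Suc l')} \<and> \<phi> i - indet i \<in> polys {1..b l'}"
    using H_block[OF assms(1)] n by blast
  have "\<phi> i - indet i \<in> polys {1..b l}"
  proof (cases "\<phi> i = indet i")
    case False
    then have "b l' < i" "\<phi> i - indet i \<in> polys {1..b l'}" using l' by auto
    moreover have "b l' \<le> b l"
    proof (rule ccontr)
      assume "\<not> b l' \<le> b l"
      then have "Suc l \<le> l'" using b_le[of l' l] assms by (metis not_less_eq_eq less_imp_le)
      then show False using b_le[of "Suc l" l'] l' assms(3) \<open>b l' < i\<close> by auto
    qed
    ultimately show ?thesis using polys_mono[of "{1..b l'}" "{1..b l}"] by auto
  qed simp
  then show ?thesis using that[of "\<phi> i - indet i"] by simp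
qed

text \<open>On the variables up to the end of block \<open>l\<close>, each \<open>\<phi>\<close>
  adds polynomials free of that block, so it commutes with the translation of a variable of the
  block.\<close>

lemma hasse_invs:
  assumes "p \<in> invs (Suc l)" "l < N" "j \<in> {b l<..b (Suc l)}"
  shows "hasse j s p \<in> invs (Suc l)"
proof -
  let ?\<omega> = "\<lambda>i. if i = j then [:indet j, 1:] else [:indet i:] :: (nat, 'k) mpolynomial poly"
  have "subst \<phi> (hasse j s p) = hasse j s p" if \<phi>: "\<phi> \<in> H" for \<phi>
    unfolding hasse_def
  proof (rule expand_invariant[where W = "{1..b (Suc l)}", OF ring_map_subst subst_const])
    fix i assume i: "i \<in> {1..b (Suc l)}"
    obtain d where d: "\<phi> i = indet i + d" "d \<in> polys {1..b l}"
      using moved_part[OF \<phi> assms(2) i] by blast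
    \<comment> \<open>The translated variable \<open>j\<close> does not occur in
      \<open>d\<close>.\<close>
    have "expand ?\<omega> d = [:d:]"
      using d(2) assms(3) by (intro expand_pCons) auto
    then show "expand ?\<omega> (subst \<phi> (indet i)) = map_poly (subst \<phi>) (?\<omega> i)"
      using d(1) by (auto simp: ring_map.map_add[OF ring_map_expand] expand_indet map_poly_pCons
          ring_map.map_one[OF ring_map_subst])
  qed (use assms that in \<open>auto simp: invs_def\<close>)
  then show ?thesis
    using assms by (auto simp: invs_def hasse_polys)
qed

text \<open>The elements of \<open>H\<close> send variables to linear forms and therefore respect
  the grading.\<close>

lemma hcomp_invs:
  assumes "p \<in> invs l" "l \<le> N"
  shows "hcomp d p \<in> invs l"
proof -
  have "subst \<phi> (hcomp d p) = hcomp d p" if "\<phi> \<in> H" for \<phi>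
    unfolding hcomp_def
  proof (rule expand_invariant[where W = "{1..n}", OF ring_map_subst subst_const])
    fix i assume "i \<in> {1..n}"
    then have "homogeneous 1 (\<phi> i - indet i)"
      using H_block[OF that] by (cases "\<phi> i = indet i") auto
    moreover have "homogeneous 1 (indet i :: (nat, 'k) mpolynomial)"
      by (simp add: indet_def homogeneous_single)
    ultimately have "homogeneous 1 (\<phi> i)"
      using homogeneous_add[of 1 "\<phi> i - indet i" "indet i"] by simp
    then show "expand (\<lambda>i. [:0, indet i:]) (subst \<phi> (indet i)) = map_poly (subst \<phi>) [:0, indet i:]"
      by (simp add: expand_linear_form map_poly_pCons)
  qed (use assms that invs_polys in \<open>auto simp: invs_def\<close>)
  then show ?thesis
    using assms by (auto simp: invs_def hcomp_polys)
qed

text \<open>Expanding in the variables of a block, the coefficients of an invariant are invariants in the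
  variables of the earlier blocks.\<close>

lemma mem_of_lower_coefficients:
  assumes l: "l < N"
    and J_add: "\<And>p q. p \<in> J \<Longrightarrow> q \<in> J \<Longrightarrow> p + q \<in> J" and J_0: "0 \<in> J"
    and J_mult: "\<And>p q. p \<in> J \<Longrightarrow> q \<in> polys {1..n} \<Longrightarrow> p * q \<in> J"
    and J_invs: "\<And>p. p \<in> invs l \<Longrightarrow> lookup p 0 = 0 \<Longrightarrow> p \<in> J"
    and i: "b l \<le> i" "i \<le> b (Suc l)"
    and p: "p \<in> polys {1..i}"
      "\<And>\<phi>. \<phi> \<in> H \<Longrightarrow> \<forall>j\<in>{b l<..b (Suc l)}. \<phi> j = indet j \<Longrightarrow> subst \<phi> p = p"
      "\<And>m. m \<in> keys p \<Longrightarrow> \<exists>w\<in>keys m. w \<le> b l"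
  shows "p \<in> J"
  using i p
proof (induction i arbitrary: p rule: dec_induct)
  \<comment> \<open>No variable of block \<open>l\<close> is left. An element of \<open>H\<close>
    that moves block \<open>l\<close> fixes all variables before it, and the other elements fix
    \<open>p\<close> by assumption, so \<open>p\<close> is an invariant in the lower
    variables.\<close>
  case base
  have "subst \<phi> p = p" if \<phi>: "\<phi> \<in> H" for \<phi>
  proof (cases "\<forall>j\<in>{b l<..b (Suc l)}. \<phi> j = indet j")
    case False
    then obtain j where j: "j \<in> {b l<..b (Suc l)}" "\<phi> j \<noteq> indet j" by blast
    obtain l' where l': "l' < N" "\<And>i. i \<in> {1..n} \<Longrightarrow> \<phi> i \<noteq> indet i \<Longrightarrow> i \<in> {b l'<..b (Suc l')}"
      using H_block[OF \<phi>] by blast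
    have "j \<in> {1..n}" using j b_le_n[of "Suc l"] l by auto
    then have "l = l'" using block_unique[OF j(1) l'(2)] j(2) l l'(1) by blast
    then have "\<phi> i = indet i" if "i \<in> {1..b l}" for i
      using l'(2)[of i] that b_le_n[of l] l by fastforce
    then show ?thesis using base.prems(2) by (intro subst_indet_ident) auto
  qed (use base that in blast)
  moreover have "lookup p 0 = 0"
    using base.prems(4)[of 0] by (auto simp: in_keys_iff)
  ultimately show ?case
    using base.prems(2) by (intro J_invs) (auto simp: invs_def)
next
  case (step i)
  have ins: "{1..Suc i} = insert (Suc i) {1..i}" by auto
  \<comment> \<open>The last variable is split off. Reading off its coefficients commutes with
    substitutions that fix block \<open>l\<close>, which is why the induction only assumes
    invariance under those.\<close>
  have "vcoeff (Suc i) s p \<in> J" for s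
  proof (rule step.IH)
    show "vcoeff (Suc i) s p \<in> polys {1..i}"
      using step.prems(2) unfolding ins by (rule vcoeff_polys)
    show "subst \<phi> (vcoeff (Suc i) s p) = vcoeff (Suc i) s p"
      if \<phi>: "\<phi> \<in> H" "\<forall>j\<in>{b l<..b (Suc l)}. \<phi> j = indet j" for \<phi>
      unfolding vcoeff_def
    proof (rule expand_invariant[where W = "{1..Suc i}", OF ring_map_subst subst_const])
      let ?\<omega> = "\<lambda>k. if k = Suc i then [:0, 1:] else [:indet k:] :: (nat, 'k) mpolynomial poly"
      fix k assume k: "k \<in> {1..Suc i}"
      show "expand ?\<omega> (subst \<phi> (indet k)) = map_poly (subst \<phi>) (?\<omega> k)"
      proof (cases "k \<le> b l")
        case True
        then obtain d where d: "\<phi> k = indet k + d" "d \<in> polys {1..b l}"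
          using moved_part[OF \<phi>(1) l, of k] k step.prems(1) step.hyps(1) by auto
        have "expand ?\<omega> d = [:d:]"
          using d(2) step.hyps(1) by (intro expand_pCons) auto
        then show ?thesis
          using d(1) True step.hyps(1) by (auto simp: ring_map.map_add[OF ring_map_expand] expand_indet
              map_poly_pCons ring_map.map_one[OF ring_map_subst])
      next
        case False
        then have "\<phi> k = indet k" using that(2) k step.prems(1) by auto
        then show ?thesis
          by (auto simp: expand_indet map_poly_pCons ring_map.map_one[OF ring_map_subst])
      qed
    qed (use step.prems that in auto)
    \<comment> \<open>Removing variable \<open>Suc i\<close> cannot remove the early variable, since
      \<open>Suc i\<close> is greater than \<open>b l\<close>.\<close>
    show "\<exists>w\<in>keys m. w \<le> b l" if m: "m \<in> keys (vcoeff (Suc i) s p)" for m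
    proof -
      obtain w where "w \<in> keys (m + single (Suc i) s)" "w \<le> b l"
        using step.prems(4) keys_vcoeff[OF m] by blast
      then show ?thesis
        using step.hyps(1) by (intro bexI[of _ w]) (auto simp: in_keys_iff lookup_add lookup_single when_def)
    qed
  qed (use step.prems(1) in auto)
  moreover have "indet (Suc i) ^ s \<in> polys {1..n}" for s
    using step.prems(1) b_le_n[of "Suc l"] l by (intro polys_power polys_indet) auto
  ultimately have *: "vcoeff (Suc i) s p * indet (Suc i) ^ s \<in> J" for s
    by (rule J_mult)
  have "(\<Sum>s\<in>A. vcoeff (Suc i) s p * indet (Suc i) ^ s) \<in> J" for A
    by (induction A rule: infinite_finite_induct) (simp_all add: J_0 J_add *)
  then show ?case
    by (subst vcoeff_expansion[of p "Suc i"])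
qed

end

text \<open>All exponents are bounded by the degree. This finiteness makes the descent on trailing
  monomials terminate.\<close>

lemma finite_monomials: "finite A \<Longrightarrow> finite {m :: 'w \<Rightarrow>\<^sub>0 nat. keys m \<subseteq> A \<and> mdeg m = d}"
proof -
  assume A: "finite A"
  let ?M = "{m :: 'w \<Rightarrow>\<^sub>0 nat. keys m \<subseteq> A \<and> mdeg m = d}"
  have "lookup m x \<le> d" if "m \<in> ?M" for m x
    using that member_le_sum[of x "keys m" "lookup m"]
    by (cases "x \<in> keys m") (auto simp: mdeg_def in_keys_iff)
  then have "lookup ` ?M \<subseteq> {f. \<forall>x. (x \<in> A \<longrightarrow> f x \<in> {..d}) \<and> (x \<notin> A \<longrightarrow> f x = 0)}"
    by (auto simp: subset_iff in_keys_iff)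
  then have "finite (lookup ` ?M)"
    using finite_set_of_finite_funs[OF A finite_atMost] by (rule finite_subset)
  moreover have "inj_on lookup ?M"
    by (rule inj_onI) (simp only: poly_mapping_eq_iff)
  ultimately show ?thesis
    by (rule finite_imageD)
qed

lemma less_poly_mapping_iff:
  "(a :: nat \<Rightarrow>\<^sub>0 nat) < m \<longleftrightarrow> (\<exists>k. lookup a k < lookup m k \<and> (\<forall>k'<k. lookup a k' = lookup m k'))"
  by (simp add: less_poly_mapping.rep_eq less_fun_def)

text \<open>A monomial without variables up to \<open>c\<close> would be smaller than
  \<open>a\<close>, contradicting that \<open>a\<close> is trailing.\<close>

lemma trailing_small_variable:
  assumes "trailing p a" "w \<in> keys a" "w \<le> c" "m \<in> keys p"
  shows "\<exists>w\<in>keys m. w \<le> c"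
proof (cases "a = m")
  case False
  then have "a < m" using assms by (auto simp: trailing_def order_le_less)
  then obtain k where k: "lookup a k < lookup m k" "\<And>k'. k' < k \<Longrightarrow> lookup a k' = lookup m k'"
    by (auto simp: less_poly_mapping_iff)
  show ?thesis
  proof (cases "w < k")
    case True
    then show ?thesis using k(2)[OF True] assms(2,3) by (auto simp: in_keys_iff)
  next
    case False
    then show ?thesis using k(1) assms(3) by (intro bexI[of _ k]) (auto simp: in_keys_iff)
  qed
qed (use assms in auto)

section \<open>Invariants whose trailing monomial is a power of one variable\<close>

context block_substitutions
begin

text \<open>The number \<open>l\<close> is the block containing \<open>j\<close>. Variables of later
  blocks are excluded from \<open>F\<close> so that \<open>hasse_invs\<close> applies to it.\<close>

definition pure_inv :: "nat \<Rightarrow> nat \<Rightarrow> (nat, 'k) mpolynomial \<Rightarrow> bool" where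
  "pure_inv j q F \<longleftrightarrow> 0 < q \<and> (\<exists>l<N. j \<in> {b l<..b (Suc l)} \<and> F \<in> invs (Suc l)) \<and>
     homogeneous q F \<and> trailing F (single j q)"

text \<open>In this locale \<open>H\<close> may generate an infinite group, and then a variable may
  have no such invariant.\<close>

definition pure_vars :: "nat set" where
  "pure_vars = {j. \<exists>q F. pure_inv j q F}"

text \<open>For \<open>j\<close> in \<open>pure_vars\<close>, \<open>pure_exp j\<close> and
  \<open>pure_gen j\<close> are the \<open>q\<^sub>j\<close> and \<open>f\<^sub>j\<close> of the
  introduction.\<close>

definition pure_exp :: "nat \<Rightarrow> nat" where
  "pure_exp j = (LEAST q. \<exists>F. pure_inv j q F)"

definition pure_gen :: "nat \<Rightarrow> (nat, 'k) mpolynomial" where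
  "pure_gen j = (SOME F. pure_inv j (pure_exp j) F)"

lemma pure_gen: "j \<in> pure_vars \<Longrightarrow> pure_inv j (pure_exp j) (pure_gen j)"
proof -
  assume "j \<in> pure_vars"
  then have "\<exists>q F. pure_inv j q F" by (simp add: pure_vars_def)
  then have "\<exists>F. pure_inv j (pure_exp j) F" unfolding pure_exp_def by (rule LeastI_ex)
  then show ?thesis unfolding pure_gen_def by (rule someI_ex)
qed

lemma pure_exp_le: "pure_inv j q F \<Longrightarrow> pure_exp j \<le> q"
  unfolding pure_exp_def by (rule Least_le) blast

lemma pure_vars_subset: "pure_vars \<subseteq> {1..n}"
proof
  fix j assume "j \<in> pure_vars"
  then obtain l where "l < N" "j \<in> {b l<..b (Suc l)}"
    by (auto simp: pure_vars_def pure_inv_def)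
  then show "j \<in> {1..n}" using b_le_n[of "Suc l"] by auto
qed

lemma finite_pure_vars: "finite pure_vars"
  by (rule finite_subset[OF pure_vars_subset]) simp

lemma pure_gen_invs:
  assumes "j \<in> pure_vars" "j \<in> {b l<..b (Suc l)}" "l < N"
  shows "pure_gen j \<in> invs (Suc l)"
proof -
  obtain l' where "l' < N" "j \<in> {b l'<..b (Suc l')}" "pure_gen j \<in> invs (Suc l')"
    using pure_gen[OF assms(1)] by (auto simp: pure_inv_def)
  then show ?thesis using block_unique[of j l l'] assms by auto
qed

lemma invs_mono:
  assumes "l \<le> l'" "l' \<le> N" "p \<in> invs l"
  shows "p \<in> invs l'"
  using assms(3) b_le[OF assms(1,2)] polys_mono[of "{1..b l}" "{1..b l'}"] by (auto simp: invs_def)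

lemma pure_gen_invs_N: "j \<in> pure_vars \<Longrightarrow> pure_gen j \<in> invs N"
  using pure_gen[of j] invs_mono[OF Suc_leI order_refl] by (auto simp: pure_inv_def)

text \<open>Differentiating in each variable \<open>i\<close> other than \<open>j\<close> to its
  full exponent removes \<open>i\<close> from the trailing monomial, with binomial coefficient 1. A
  last derivative of order \<open>lookup a j - r\<close> in \<open>j\<close> lowers the exponent of
  \<open>j\<close> to \<open>r\<close>.\<close>

lemma pure_inv_by_hasse:
  assumes "l < N" "p \<in> invs (Suc l)" "homogeneous d p" "trailing p a"
    and "keys a \<subseteq> {b l<..b (Suc l)}" "j \<in> {b l<..b (Suc l)}"
    and "0 < r" "r \<le> lookup a j" "of_nat (lookup a j choose r) \<noteq> (0::'k)"
  shows "\<exists>F. pure_inv j r F"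
  using assms(2-5,7-)
proof (induction "card (keys a - {j})" arbitrary: p a d)
  case 0
  then have "keys a \<subseteq> {j}" by auto
  then have a: "a = single j r + single j (lookup a j - r)"
    using \<open>r \<le> lookup a j\<close>
    by (intro poly_mapping_eqI) (auto simp: lookup_add lookup_single when_def in_keys_iff)
  \<comment> \<open>By symmetry of binomial coefficients, choosing \<open>lookup a j - r\<close>
    gives the same nonzero value as choosing \<open>r\<close>.\<close>
  have "of_nat (r + (lookup a j - r) choose (lookup a j - r)) \<noteq> (0::'k)"
    using 0 binomial_symmetric[of r "lookup a j"] by simp
  then have tr: "trailing (hasse j (lookup a j - r) p) (single j r)"
    using trailing_hasse[of p "single j r" j "lookup a j - r"] 0 a by simp
  have h: "homogeneous (d - (lookup a j - r)) (hasse j (lookup a j - r) p)"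
    by (rule hasse_homogeneous) fact
  \<comment> \<open>The degree of a homogeneous polynomial can be read off its trailing
    monomial.\<close>
  with tr have "d - (lookup a j - r) = r"
    by (auto simp: homogeneous_def trailing_def)
  then have "pure_inv j r (hasse j (lookup a j - r) p)"
    using tr h 0 hasse_invs[OF _ assms(1,6)] assms(1,6) by (auto simp: pure_inv_def)
  then show ?case by blast
next
  case (Suc k)
  then obtain i where i: "i \<in> keys a" "i \<noteq> j"
    by (metis card.empty ex_in_conv Diff_iff singletonI nat.distinct(1))
  let ?s = "lookup a i"
  define a' where "a' = a - single i ?s"
  have a: "a = a' + single i ?s"
    unfolding a'_def by (intro poly_mapping_eqI) (auto simp: lookup_add lookup_minus lookup_single when_def)
  have a'i: "lookup a' i = 0" and a'j: "lookup a' j = lookup a j"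
    unfolding a'_def using i by (auto simp: lookup_minus lookup_single when_def)
  have k': "keys a' = keys a - {i}"
    unfolding a'_def by (auto simp: in_keys_iff lookup_minus lookup_single when_def split: if_splits)
  have "k = card (keys a' - {j})"
  proof -
    have "keys a' - {j} = (keys a - {j}) - {i}" using k' by auto
    then show ?thesis using Suc(2) i by simp
  qed
  moreover have "hasse i ?s p \<in> invs (Suc l)"
    using Suc.prems i by (intro hasse_invs assms(1)) auto
  moreover have "trailing (hasse i ?s p) a'"
    using Suc.prems(3) a a'i by (intro trailing_hasse) auto
  ultimately show ?case
    using Suc.hyps(1)[of a' "hasse i ?s p" "d - ?s"] Suc.prems k' a'j
    by (auto intro: hasse_homogeneous)
qed

text \<open>Minimality of \<open>q\<close> makes the inner binomial coefficients of \<open>q\<close>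
  vanish, which allows \<open>lookup a j\<close> to be reduced modulo \<open>q\<close>. A nonzero
  remainder would itself be the exponent of a pure invariant, against minimality.\<close>

lemma pure_exp_dvd:
  assumes "l < N" "p \<in> invs (Suc l)" "homogeneous d p" "trailing p a"
    and "keys a \<subseteq> {b l<..b (Suc l)}" "j \<in> keys a"
  shows "j \<in> pure_vars" and "pure_exp j dvd lookup a j"
proof -
  note ph = pure_inv_by_hasse[OF assms(1-5), of j]
  have j: "j \<in> {b l<..b (Suc l)}" using assms by auto
  have "\<exists>F. pure_inv j (lookup a j) F"
    using ph[OF j] assms(6) by (simp add: in_keys_iff)
  then show jv: "j \<in> pure_vars" by (auto simp: pure_vars_def)
  define q where "q = pure_exp j"
  have q: "pure_inv j q (pure_gen j)" using pure_gen[OF jv] by (simp add: q_def)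
  have q0: "0 < q" using q by (simp add: pure_inv_def)
  have bin: "of_nat (q choose i) = (0::'k)" if "0 < i" "i < q" for i
  proof (rule ccontr)
    assume "of_nat (q choose i) \<noteq> (0::'k)"
    then have "\<exists>F. pure_inv j i F"
      using q that pure_gen_invs[OF jv j assms(1)] j
      by (intro pure_inv_by_hasse[OF assms(1), of "pure_gen j" q "single j q"]) (auto simp: pure_inv_def)
    then obtain F where "pure_inv j i F" by blast
    from pure_exp_le[OF this] show False using that by (simp add: q_def)
  qed
  show "pure_exp j dvd lookup a j"
  proof (rule ccontr)
    assume "\<not> pure_exp j dvd lookup a j"
    then have r: "0 < lookup a j mod q" by (simp add: q_def mod_greater_zero_iff_not_dvd)
    \<comment> \<open>\<open>binomial_mod_power\<close> replaces the upper entry by the remainder,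
      leaving the remainder over itself.\<close>
    have "of_nat (lookup a j choose (lookup a j mod q)) = (1::'k)"
      using binomial_mod_power[OF q0 bin, of "lookup a j mod q" "lookup a j div q" "lookup a j mod q"] q0
      by simp
    then have "\<exists>F. pure_inv j (lookup a j mod q) F"
      using r by (intro ph[OF j]) auto
    then obtain F where "pure_inv j (lookup a j mod q) F" by blast
    from pure_exp_le[OF this] show False
      using mod_less_divisor[OF q0, of "lookup a j"] by (simp add: q_def)
  qed
qed

section \<open>The Hilbert ideal\<close>

text \<open>By \<open>invs_in_ideal\<close> this is the ideal generated by all invariants without
  constant term. The coefficients \<open>s j\<close> are explicit because
  \<open>gens_generate\<close> splits them one by one.\<close>

definition pure_ideal :: "(nat, 'k) mpolynomial set" where
  "pure_ideal = {p. \<exists>s. (\<forall>j\<in>pure_vars. s j \<in> polys {1..n}) \<and> p = (\<Sum>j\<in>pure_vars. s j * pure_gen j)}"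

lemma pure_ideal_0: "0 \<in> pure_ideal"
  unfolding pure_ideal_def by (auto intro!: exI[of _ "\<lambda>_. 0"])

lemma pure_ideal_add:
  assumes "p \<in> pure_ideal" "q \<in> pure_ideal"
  shows "p + q \<in> pure_ideal"
proof -
  obtain s t where "\<forall>j\<in>pure_vars. s j \<in> polys {1..n}" "p = (\<Sum>j\<in>pure_vars. s j * pure_gen j)"
    "\<forall>j\<in>pure_vars. t j \<in> polys {1..n}" "q = (\<Sum>j\<in>pure_vars. t j * pure_gen j)"
    using assms unfolding pure_ideal_def by blast
  then show ?thesis
    unfolding pure_ideal_def
    by (auto intro!: exI[of _ "\<lambda>j. s j + t j"] polys_add simp: distrib_right sum.distrib)
qed

lemma pure_ideal_mult:
  assumes "p \<in> pure_ideal" "q \<in> polys {1..n}"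
  shows "p * q \<in> pure_ideal"
proof -
  obtain s where "\<forall>j\<in>pure_vars. s j \<in> polys {1..n}" "p = (\<Sum>j\<in>pure_vars. s j * pure_gen j)"
    using assms unfolding pure_ideal_def by blast
  then show ?thesis
    unfolding pure_ideal_def using assms(2)
    by (auto intro!: exI[of _ "\<lambda>j. q * s j"] polys_mult simp: sum_distrib_left mult.assoc mult.commute[of _ q])
qed

lemma pure_gen_ideal:
  assumes "j \<in> pure_vars"
  shows "pure_gen j \<in> pure_ideal"
proof -
  let ?s = "\<lambda>i. if i = j then 1 else 0 :: (nat, 'k) mpolynomial"
  have "(\<Sum>i\<in>pure_vars. ?s i * pure_gen i) = (\<Sum>i\<in>pure_vars. if i = j then pure_gen i else 0)"
    by (rule sum.cong) auto
  then have "pure_gen j = (\<Sum>i\<in>pure_vars. ?s i * pure_gen i)"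
    using assms finite_pure_vars by simp
  moreover have "\<forall>i\<in>pure_vars. ?s i \<in> polys {1..n}" by simp
  ultimately show ?thesis unfolding pure_ideal_def mem_Collect_eq by (intro exI[of _ ?s] conjI)
qed

text \<open>Descent on the trailing monomial \<open>a\<close>. If \<open>a\<close> involves a
  variable before block \<open>l\<close>, then \<open>p\<close> is reduced to its lower
  coefficients, which \<open>IH\<close> covers. Otherwise a product of the \<open>pure_gen j\<close>
  has trailing monomial \<open>a\<close>, and a multiple of it is subtracted.\<close>

lemma homogeneous_invs_in_ideal:
  assumes l: "l < N" and IH: "\<And>p. p \<in> invs l \<Longrightarrow> lookup p 0 = 0 \<Longrightarrow> p \<in> pure_ideal"
    and p: "p \<in> invs (Suc l)" "homogeneous d p" and d: "0 < d"
  shows "p \<in> pure_ideal"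
proof -
  define M where "M = {m. keys m \<subseteq> {1..b (Suc l)} \<and> mdeg m = d}"
  \<comment> \<open>The measure counts the monomials of degree \<open>d\<close> at or above some
    monomial of \<open>p\<close>. Counting the monomials of \<open>p\<close> would not do, as a
    subtraction may create new, larger ones.\<close>
  define above where "above p = {m \<in> M. \<exists>m'\<in>keys p. m' \<le> m}" for p :: "(nat, 'k) mpolynomial"
  have "finite M" unfolding M_def by (rule finite_monomials) simp
  then have fin: "finite (above p)" for p by (simp add: above_def)
  show ?thesis using p
  proof (induction "card (above p)" arbitrary: p rule: less_induct)
    case less
    show ?case
    proof (cases "p = 0")
      case False
      then obtain a where a: "trailing p a" using trailing_exists by blast
      have aM: "a \<in> M"
        using a less.prems by (auto simp: M_def trailing_def homogeneous_def invs_def polys_def)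
      show ?thesis
      proof (cases "\<exists>w\<in>keys a. w \<le> b l")
        case True
        then have small: "\<exists>w\<in>keys m. w \<le> b l" if "m \<in> keys p" for m
          using trailing_small_variable[OF a _ _ that] by blast
        show ?thesis
          by (rule mem_of_lower_coefficients[OF l pure_ideal_add pure_ideal_0 pure_ideal_mult IH
                b_mono[OF l] order_refl])
            (use less.prems(1) small in \<open>auto simp: invs_def\<close>)
      next
        case False
        then have ka: "keys a \<subseteq> {b l<..b (Suc l)}"
          using aM by (fastforce simp: M_def)
        note dv = pure_exp_dvd[OF l less.prems a ka]
        \<comment> \<open>The divisibility \<open>dv(2)\<close> makes the trailing monomials of the
          factors multiply to exactly \<open>a\<close>.\<close>
        define g where "g = (\<Prod>j\<in>keys a. pure_gen j ^ (lookup a j div pure_exp j))"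
        have "trailing g (\<Sum>j\<in>keys a. single j (lookup a j div pure_exp j * pure_exp j))"
          unfolding g_def using pure_gen[OF dv(1)]
          by (intro trailing_prod trailing_power) (auto simp: pure_inv_def)
        also have "(\<Sum>j\<in>keys a. single j (lookup a j div pure_exp j * pure_exp j)) = a"
          using dv(2) by (subst (3) poly_mapping_sum_single) (auto intro!: sum.cong)
        finally have tg: "trailing g a" .
        have "homogeneous (\<Sum>j\<in>keys a. lookup a j div pure_exp j * pure_exp j) g"
          unfolding g_def using pure_gen[OF dv(1)]
          by (intro homogeneous_prod homogeneous_power) (auto simp: pure_inv_def)
        moreover have "(\<Sum>j\<in>keys a. lookup a j div pure_exp j * pure_exp j) = d"
          using dv(2) aM by (simp add: M_def mdeg_def)
        ultimately have hg: "homogeneous d g" by simp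
        have gi: "g \<in> invs (Suc l)"
          unfolding g_def using dv(1) ka l by (intro invs_prod invs_power pure_gen_invs) auto
        \<comment> \<open>Since \<open>d\<close> is positive, \<open>a\<close> is not 0 and
          \<open>g\<close> has at least one factor from the ideal.\<close>
        obtain j where j: "j \<in> keys a"
          using aM d by (cases "a = 0") (auto simp: M_def simp flip: keys_eq_empty)
        have gJ: "g \<in> pure_ideal"
        proof -
          have "0 < lookup a j div pure_exp j"
            using dv(2)[OF j] j pure_gen[OF dv(1)[OF j]]
            by (auto simp: in_keys_iff pure_inv_def dvd_imp_le div_greater_zero_iff)
          then obtain e where e: "lookup a j div pure_exp j = Suc e" using gr0_conv_Suc by blast
          have "g = pure_gen j * (pure_gen j ^ e * (\<Prod>i\<in>keys a - {j}. pure_gen i ^ (lookup a i div pure_exp i)))"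
            unfolding g_def using j by (subst prod.remove[of _ j]) (auto simp: e mult.assoc)
          moreover have "pure_gen i \<in> polys {1..n}" if "i \<in> keys a" for i
            using dv(1)[OF that] pure_gen_invs_N invs_polys by blast
          ultimately show ?thesis
            using dv(1)[OF j] j
            by (auto intro!: pure_ideal_mult pure_gen_ideal polys_mult polys_power polys_prod)
        qed
        \<comment> \<open>The trailing coefficient of \<open>g\<close> is not normalised to 1, hence
          the quotient.\<close>
        define c where "c = lookup p a / lookup g a"
        define p' where "p' = p - const_poly c * g"
        have la: "lookup p' a = 0"
          using trailing_lookup[OF tg]
          by (simp add: p'_def c_def const_poly_def mult_map_scale_conv_mult[symmetric] lookup_minus
              Poly_Mapping.map.rep_eq when_def)
        have kp': "keys p' \<subseteq> keys p \<union> keys g"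
        proof -
          have "keys (const_poly c * g) \<subseteq> keys g"
            using Poly_Mapping.keys_mult[of "const_poly c" g] by (auto simp: const_poly_def split: if_splits)
          then show ?thesis
            unfolding p'_def using Poly_Mapping.keys_diff[of p "const_poly c * g"] by blast
        qed
        have hp': "homogeneous d p'"
          using less.prems(2) hg kp' by (auto simp: homogeneous_def)
        have ip': "p' \<in> invs (Suc l)"
          unfolding p'_def using less.prems(1) gi by (intro invs_diff invs_mult invs_const)
        have gt: "a < m" if "m \<in> keys p'" for m
        proof -
          have "a \<le> m" using that kp' a tg by (auto simp: trailing_def)
          moreover have "a \<noteq> m" using that la by (auto simp: in_keys_iff)
          ultimately show ?thesis by simp
        qed
        have "above p' \<subset> above p"
        proof
          show "above p' \<subseteq> above p"
            using a by (auto simp: above_def trailing_def intro!: bexI[of _ a] dest!: gt)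
          show "above p' \<noteq> above p"
          proof -
            have "a \<in> above p" using aM a by (auto simp: above_def trailing_def)
            moreover have "a \<notin> above p'" by (auto simp: above_def dest!: gt)
            ultimately show ?thesis by blast
          qed
        qed
        then have "p' \<in> pure_ideal"
          using psubset_card_mono[OF fin] ip' hp' by (intro less.hyps) auto
        moreover have "g * const_poly c \<in> pure_ideal"
          by (rule pure_ideal_mult[OF gJ]) simp
        ultimately have "p' + g * const_poly c \<in> pure_ideal" by (rule pure_ideal_add)
        then show ?thesis by (simp add: p'_def mult.commute)
      qed
    qed (simp add: pure_ideal_0)
  qed
qed

text \<open>Induction over the blocks. As \<open>b 0 = 0\<close>, only constants occur for
  \<open>l = 0\<close>, and a constant with zero constant term is 0.\<close>

lemma invs_in_ideal: "l \<le> N \<Longrightarrow> p \<in> invs l \<Longrightarrow> lookup p 0 = 0 \<Longrightarrow> p \<in> pure_ideal"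
proof (induction l arbitrary: p)
  case 0
  have "lookup p m = 0" for m
  proof (cases "m = 0")
    case False
    then have "m \<notin> keys p" using 0 by (auto simp: invs_def b_0 polys_def)
    then show ?thesis by (simp add: in_keys_iff)
  qed (use 0 in simp)
  then have "p = 0" by (intro poly_mapping_eqI) simp
  then show ?case by (simp add: pure_ideal_0)
next
  case (Suc l)
  have "hcomp d p \<in> pure_ideal" if "d \<in> mdeg ` keys p" for d
  proof (rule homogeneous_invs_in_ideal[of l])
    show "0 < d" using that Suc.prems(3) by (auto simp: in_keys_iff mdeg_eq_0_iff intro!: gr0I)
  qed (use Suc hcomp_invs hcomp_homogeneous in \<open>auto simp: Suc_le_eq\<close>)
  moreover have "(\<Sum>d\<in>A. hcomp d p) \<in> pure_ideal" if "\<And>d. d \<in> A \<Longrightarrow> hcomp d p \<in> pure_ideal" for A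
    using that by (induction A rule: infinite_finite_induct) (simp_all add: pure_ideal_0 pure_ideal_add)
  ultimately have "(\<Sum>d\<in>mdeg ` keys p. hcomp d p) \<in> pure_ideal" by blast
  then show ?case using sum_hcomp[of p] by simp
qed

text \<open>Hilbert's argument with the complement \<open>C\<close> in place of an averaging
  operator. Write \<open>p\<close> as a combination of the \<open>pure_gen j\<close> and split each
  coefficient into an invariant and an element of \<open>C\<close>. The contribution of
  \<open>C\<close> is both invariant and in \<open>C\<close>, so it is 0. Induction on the degree
  puts the invariant coefficients into the subalgebra \<open>A\<close>.\<close>

lemma gens_generate:
  assumes N_add: "\<And>p q. p \<in> C \<Longrightarrow> q \<in> C \<Longrightarrow> p + q \<in> C" and N_0: "0 \<in> C"
    and N_mult: "\<And>p q. p \<in> C \<Longrightarrow> q \<in> invs N \<Longrightarrow> p * q \<in> C"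
    and N_inter: "\<And>p. p \<in> invs N \<Longrightarrow> p \<in> C \<Longrightarrow> p = 0"
    and N_split: "\<And>p. p \<in> polys {1..n} \<Longrightarrow> \<exists>a\<in>invs N. p - a \<in> C"
    and A_add: "\<And>p q. p \<in> A \<Longrightarrow> q \<in> A \<Longrightarrow> p + q \<in> A"
    and A_mult: "\<And>p q. p \<in> A \<Longrightarrow> q \<in> A \<Longrightarrow> p * q \<in> A"
    and A_const: "\<And>c. const_poly c \<in> A"
    and A_gen: "\<And>j. j \<in> pure_vars \<Longrightarrow> pure_gen j \<in> A"
    and p: "p \<in> invs N"
  shows "p \<in> A"
proof -
  have A_0: "0 \<in> A" using A_const[of 0] by (simp add: const_poly_def)
  have A_sum: "sum f B \<in> A" if "\<And>a. a \<in> B \<Longrightarrow> f a \<in> A" for f :: "nat \<Rightarrow> _" and B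
    using that by (induction B rule: infinite_finite_induct) (simp_all add: A_0 A_add)
  have hom: "p \<in> A" if "p \<in> invs N" "homogeneous d p" for p d
    using that
  proof (induction d arbitrary: p rule: less_induct)
    case (less d)
    show ?case
    proof (cases "d = 0")
      case True
      then have "p = const_poly (lookup p 0)"
        using less.prems(2) by (intro poly_mapping_eqI)
          (auto simp: const_poly_def lookup_single when_def homogeneous_def mdeg_eq_0_iff in_keys_iff)
      then show ?thesis using A_const by metis
    next
      case False
      then have "lookup p 0 = 0" using less.prems(2) by (force simp: homogeneous_def in_keys_iff)
      then have "p \<in> pure_ideal" using invs_in_ideal less.prems by blast
      then obtain s where s: "\<And>j. j \<in> pure_vars \<Longrightarrow> s j \<in> polys {1..n}"
        "p = (\<Sum>j\<in>pure_vars. s j * pure_gen j)"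
        unfolding pure_ideal_def by blast
      obtain a where a: "\<And>j. j \<in> pure_vars \<Longrightarrow> a j \<in> invs N" "\<And>j. j \<in> pure_vars \<Longrightarrow> s j - a j \<in> C"
        using N_split[OF s(1)] by metis
      have "p - (\<Sum>j\<in>pure_vars. a j * pure_gen j) = (\<Sum>j\<in>pure_vars. (s j - a j) * pure_gen j)"
        by (simp add: s(2) sum_subtractf[symmetric] left_diff_distrib)
      also have "\<dots> \<in> C"
      proof -
        have "sum f B \<in> C" if "\<And>j. j \<in> B \<Longrightarrow> f j \<in> C" for f :: "nat \<Rightarrow> _" and B
          using that by (induction B rule: infinite_finite_induct) (simp_all add: N_0 N_add)
        moreover have "(s j - a j) * pure_gen j \<in> C" if "j \<in> pure_vars" for j
          using that by (intro N_mult a(2) pure_gen_invs_N)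
        ultimately show ?thesis by simp
      qed
      finally have "p - (\<Sum>j\<in>pure_vars. a j * pure_gen j) \<in> C" .
      moreover have "p - (\<Sum>j\<in>pure_vars. a j * pure_gen j) \<in> invs N"
        using less.prems a(1) pure_gen_invs_N by (intro invs_diff invs_sum invs_mult) auto
      ultimately have "p = (\<Sum>j\<in>pure_vars. a j * pure_gen j)"
        using N_inter by fastforce
      \<comment> \<open>The \<open>a j\<close> need not be homogeneous. Comparing components of
        degree \<open>d\<close> replaces them by invariants of degree \<open>d - pure_exp j\<close>,
        which is less than \<open>d\<close>.\<close>
      then have "p = hcomp d (\<Sum>j\<in>pure_vars. a j * pure_gen j)"
        using hcomp_ident[OF less.prems(2), of d] by simp
      also have "\<dots> = (\<Sum>j\<in>pure_vars. if pure_exp j \<le> d then hcomp (d - pure_exp j) (a j) * pure_gen j else 0)"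
        unfolding hcomp_sum using pure_gen
        by (intro sum.cong refl hcomp_mult) (simp add: pure_inv_def)
      also have "\<dots> \<in> A"
      proof (rule A_sum)
        fix j assume j: "j \<in> pure_vars"
        have "0 < pure_exp j" using pure_gen[OF j] by (simp add: pure_inv_def)
        then have "hcomp (d - pure_exp j) (a j) \<in> A"
          using False a(1)[OF j] by (intro less.IH[of "d - pure_exp j"] hcomp_invs hcomp_homogeneous) auto
        then show "(if pure_exp j \<le> d then hcomp (d - pure_exp j) (a j) * pure_gen j else 0) \<in> A"
          using A_mult A_gen[OF j] A_0 by simp
      qed
      finally show ?thesis .
    qed
  qed
  have "(\<Sum>d\<in>mdeg ` keys p. hcomp d p) \<in> A"
    by (intro A_sum hom[OF hcomp_invs[OF p order_refl] hcomp_homogeneous])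
  then show ?thesis using sum_hcomp[of p] by simp
qed

end

text \<open>Distinct products of the \<open>F i\<close> have distinct trailing monomials, so they cannot cancel.\<close>

lemma subst_inj_of_trailing:
  fixes F :: "nat \<Rightarrow> (nat, 'k::field) mpolynomial"
  assumes "inj_on e V" "\<And>i. i \<in> V \<Longrightarrow> 0 < q i" "\<And>i. i \<in> V \<Longrightarrow> trailing (F i) (single (e i) (q i))"
  shows "inj_on (subst F) (polys V)"
proof -
  have zero: "Q = 0" if Q: "Q \<in> polys V" "subst F Q = 0" for Q
  proof (rule ccontr)
    assume "Q \<noteq> 0"
    \<comment> \<open>\<open>t m\<close> is the trailing monomial of the product of the
      \<open>F i\<close> with exponent vector \<open>m\<close>.\<close>
    define t where "t m = (\<Sum>i\<in>keys m. single (e i) (lookup m i * q i))" for m :: "nat \<Rightarrow>\<^sub>0 nat"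
    have lt: "lookup (t m) (e i) = lookup m i * q i" if "keys m \<subseteq> V" "i \<in> V" for m i
    proof -
      have "lookup (t m) (e i) = (\<Sum>i'\<in>keys m. if i' = i then lookup m i' * q i' else 0)"
        unfolding t_def lookup_sum using that assms(1)
        by (intro sum.cong) (auto simp: lookup_single when_def inj_on_def)
      then show ?thesis by (auto simp: in_keys_iff)
    qed
    have t_inj: "m = m'" if "keys m \<subseteq> V" "keys m' \<subseteq> V" "t m = t m'" for m m'
    proof (rule poly_mapping_eqI)
      fix i show "lookup m i = lookup m' i"
      proof (cases "i \<in> V")
        case True
        then show ?thesis using that lt[of m i] lt[of m' i] assms(2)[of i] by simp
      next
        case False
        then have "i \<notin> keys m" "i \<notin> keys m'" using that by auto
        then show ?thesis by (simp add: in_keys_iff)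
      qed
    qed
    have tr: "trailing (monom_eval F m) (t m)" if "keys m \<subseteq> V" for m
      unfolding monom_eval_def t_def using that assms(3) by (intro trailing_prod trailing_power) auto
    have "\<exists>m. is_arg_min t (\<lambda>m. m \<in> keys Q) m"
      by (rule ex_is_arg_min_if_finite) (use \<open>Q \<noteq> 0\<close> in auto)
    then obtain m0 where m0: "m0 \<in> keys Q" "\<And>m. m \<in> keys Q \<Longrightarrow> t m0 \<le> t m"
      by (auto simp: is_arg_min_linorder)
    note kV = polysD[OF Q(1)]
    \<comment> \<open>By the choice of \<open>m0\<close>, every other product has its trailing
      monomial strictly above \<open>t m0\<close>, so only \<open>m0\<close> contributes
      there.\<close>
    have "lookup (const_poly (lookup Q m) * monom_eval F m) (t m0)
        = (if m = m0 then lookup Q m0 * lookup (monom_eval F m0) (t m0) else 0)" if "m \<in> keys Q" for m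
    proof -
      have "lookup (const_poly (lookup Q m) * monom_eval F m) (t m0) = lookup Q m * lookup (monom_eval F m) (t m0)"
        by (simp add: const_poly_def mult_map_scale_conv_mult[symmetric] Poly_Mapping.map.rep_eq when_def)
      moreover have "lookup (monom_eval F m) (t m0) = 0" if "m \<noteq> m0"
      proof -
        have "t m0 < t m"
          using m0 \<open>m \<in> keys Q\<close> that t_inj[of m m0] kV by (metis order.not_eq_order_implies_strict)
        then have "t m0 \<notin> keys (monom_eval F m)"
          using tr[of m] kV[OF \<open>m \<in> keys Q\<close>] by (auto simp: trailing_def)
        then show ?thesis by (simp add: in_keys_iff)
      qed
      ultimately show ?thesis by auto
    qed
    then have "lookup (subst F Q) (t m0) = lookup Q m0 * lookup (monom_eval F m0) (t m0)"
      using m0(1) by (simp add: poly_eval_def lookup_sum)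
    moreover have "lookup (monom_eval F m0) (t m0) \<noteq> 0"
      using tr[OF kV[OF m0(1)]] by (rule trailing_lookup)
    ultimately show False
      using Q(2) m0(1) by (auto simp: in_keys_iff)
  qed
  show ?thesis
  proof (rule inj_onI)
    fix P Q assume "P \<in> polys V" "Q \<in> polys V" "subst F P = subst F Q"
    then show "P = Q"
      using zero[of "P - Q"] by (simp add: polys_diff ring_map.map_diff[OF ring_map_subst])
  qed
qed

text \<open>The \<open>F i\<close> are the \<open>pure_gen j\<close>, renumbered from 0. Their
  trailing monomials give injectivity of \<open>subst F\<close>, and \<open>gens_generate\<close>
  gives surjectivity.\<close>

theorem (in block_substitutions) invs_polynomial:
  assumes "\<And>p q. p \<in> C \<Longrightarrow> q \<in> C \<Longrightarrow> p + q \<in> C" and "0 \<in> C"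
    and "\<And>p q. p \<in> C \<Longrightarrow> q \<in> invs N \<Longrightarrow> p * q \<in> C"
    and "\<And>p. p \<in> invs N \<Longrightarrow> p \<in> C \<Longrightarrow> p = 0"
    and "\<And>p. p \<in> polys {1..n} \<Longrightarrow> \<exists>a\<in>invs N. p - a \<in> C"
  shows "\<exists>(m::nat) F. bij_betw (subst F) (polys {..<m}) (invs N)"
proof -
  obtain e where e: "bij_betw e {..<card pure_vars} pure_vars"
    using ex_bij_betw_nat_finite[OF finite_pure_vars] by (auto simp: atLeast0LessThan)
  define V where "V = {..<card pure_vars}"
  define F where "F i = pure_gen (e i)" for i
  have eV: "e i \<in> pure_vars" if "i \<in> V" for i
    using e that by (auto simp: bij_betw_def V_def)
  note pg = pure_gen[OF eV]
  have "inj_on (subst F) (polys V)"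
    by (rule subst_inj_of_trailing[of e V "\<lambda>i. pure_exp (e i)"])
      (use e pg in \<open>auto simp: bij_betw_def V_def F_def pure_inv_def\<close>)
  moreover have "subst F Q \<in> invs N" if "Q \<in> polys V" for Q
    unfolding poly_eval_def monom_eval_def F_def using polysD[OF that] eV
    by (intro invs_sum invs_mult invs_const invs_prod invs_power pure_gen_invs_N) blast
  moreover have "p \<in> subst F ` polys V" if "p \<in> invs N" for p
  \<comment> \<open>The subalgebra \<open>A\<close> is the image of \<open>subst F\<close>.\<close>
  proof (rule gens_generate[of C, OF assms])
    show "const_poly c \<in> subst F ` polys V" for c
      by (rule image_eqI[of _ _ "const_poly c"]) simp_all
    show "pure_gen j \<in> subst F ` polys V" if j: "j \<in> pure_vars" for j
    proof -
      have "j \<in> e ` V" using e j by (simp add: bij_betw_def V_def)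
      then obtain i where i: "i \<in> V" "e i = j" by blast
      show ?thesis
        by (rule image_eqI[of _ _ "indet i"]) (simp_all add: F_def polys_indet i)
    qed
    fix p q assume "p \<in> subst F ` polys V" "q \<in> subst F ` polys V"
    then obtain P Q where "P \<in> polys V" "p = subst F P" "Q \<in> polys V" "q = subst F Q" by blast
    then have "p + q = subst F (P + Q)" "p * q = subst F (P * Q)" "P + Q \<in> polys V" "P * Q \<in> polys V"
      by (simp_all add: ring_map.map_add[OF ring_map_subst] ring_map.map_mult[OF ring_map_subst]
          polys_add polys_mult)
    then show "p + q \<in> subst F ` polys V" "p * q \<in> subst F ` polys V"
      by (simp_all only: imageI)
  qed (assumption | rule that)+
  ultimately have "bij_betw (subst F) (polys V) (invs N)"
    by (auto simp: bij_betw_def)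
  then show ?thesis unfolding V_def by blast
qed

section \<open>The symmetric algebra in coordinates\<close>

lemma vector_space_dual_scale: "vector_space (dual_scale :: 'k::field \<Rightarrow> ('v \<Rightarrow> 'k) \<Rightarrow> _)"
  by unfold_locales (auto simp: dual_scale_def fun_eq_iff algebra_simps)

interpretation dual_vs: vector_space "dual_scale :: 'k::field \<Rightarrow> ('v \<Rightarrow> 'k) \<Rightarrow> _"
  by (rule vector_space_dual_scale)

lemma poly_ring_simps:
  "carrier (poly_ring W) = polys W" "monoid.mult (poly_ring W) = (*)" "one (poly_ring W) = 1"
  "ring.zero (poly_ring W) = 0" "ring.add (poly_ring W) = (+)"
  by (simp_all add: poly_ring_def polys_def)

lemma cring_poly_ring: "cring (poly_ring W)"
proof (rule cringI)
  show "abelian_group (poly_ring W)"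
  proof (rule abelian_groupI)
    show "\<exists>y\<in>carrier (poly_ring W). y \<oplus>\<^bsub>poly_ring W\<^esub> x = \<zero>\<^bsub>poly_ring W\<^esub>"
      if "x \<in> carrier (poly_ring W)" for x
      using that by (intro bexI[of _ "- x"]) (simp_all add: poly_ring_simps polys_uminus)
  qed (simp_all add: poly_ring_simps polys_add add_ac)
  show "comm_monoid (poly_ring W)"
    by (rule comm_monoidI) (simp_all add: poly_ring_simps polys_mult mult_ac)
qed (simp add: poly_ring_simps distrib_right)

lemma poly_ring_a_inv: "p \<in> polys W \<Longrightarrow> \<ominus>\<^bsub>poly_ring W\<^esub> p = - p"
proof -
  assume p: "p \<in> polys W"
  interpret cring "poly_ring W" by (rule cring_poly_ring)
  show ?thesis
    by (rule minus_equality) (use p in \<open>simp_all add: poly_ring_simps polys_uminus\<close>)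
qed

text \<open>Complements \<open>ring_map_eqI\<close> for statements that are not equations between
  ring maps, such as membership in an ideal.\<close>

lemma polys_induct [consumes 1, case_names const indet add mult]:
  assumes "p \<in> polys W" "\<And>c. P (const_poly c)" "\<And>w. w \<in> W \<Longrightarrow> P (indet w)"
    "\<And>p q. p \<in> polys W \<Longrightarrow> q \<in> polys W \<Longrightarrow> P p \<Longrightarrow> P q \<Longrightarrow> P (p + q)"
    "\<And>p q. p \<in> polys W \<Longrightarrow> q \<in> polys W \<Longrightarrow> P p \<Longrightarrow> P q \<Longrightarrow> P (p * q)"
  shows "P p"
proof -
  have P0: "P 0" and P1: "P 1"
    using assms(2)[of 0] assms(2)[of 1] by (simp_all add: const_poly_def)
  have pow: "P (indet w ^ k)" if "w \<in> W" for w k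
    using that by (induction k) (auto intro: P1 assms(3,5) polys_indet polys_power)
  have pr: "P (\<Prod>w\<in>A. indet w ^ f w) \<and> (\<Prod>w\<in>A. indet w ^ f w :: ('a, 'b) mpolynomial) \<in> polys W"
    if "A \<subseteq> W" for A and f :: "'a \<Rightarrow> nat"
    using that by (induction A rule: infinite_finite_induct)
      (auto intro: P1 pow assms(5) polys_indet polys_power polys_mult)
  have mon: "P (single m c)" if "keys m \<subseteq> W" for m c
    unfolding single_eq_const_mult monom_eval_def using pr[OF that] by (intro assms(5) assms(2)) auto
  have "P (\<Sum>m\<in>A. single m (f m))" if "\<And>m. m \<in> A \<Longrightarrow> keys m \<subseteq> W" for A f
    using that by (induction A rule: infinite_finite_induct)
      (auto intro!: P0 mon assms(4) polys_sum polys_single)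
  from this[of "keys p" "lookup p"] show ?thesis
    using polysD[OF assms(1)] poly_mapping_sum_single[of p] by simp
qed

section \<open>The general linear group and its action on cosets\<close>

lemma GL_simps:
  "carrier (GL scale) = {g. Vector_Spaces.linear scale scale g \<and> bij g}"
  "monoid.mult (GL scale) = (\<circ>)" "one (GL scale) = id"
  by (simp_all add: GL_def)

lemma linear_inv_into:
  assumes "vector_space scale" "Vector_Spaces.linear scale scale g" "bij g"
  shows "Vector_Spaces.linear scale scale (inv_into UNIV g)"
proof -
  interpret vector_space scale by fact
  interpret g: Vector_Spaces.linear scale scale g by fact
  have s: "surj g" and i: "inj g" using assms(3) by (auto simp: bij_def)
  show ?thesis
    unfolding Vector_Spaces.linear_iff
  proof (intro conjI allI assms(1))
    fix u v c
    have "g (inv_into UNIV g u + inv_into UNIV g v) = u + v"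
      by (simp add: g.add surj_f_inv_f[OF s])
    then show "inv_into UNIV g (u + v) = inv_into UNIV g u + inv_into UNIV g v"
      using inv_f_f[OF i, of "inv_into UNIV g u + inv_into UNIV g v"] by simp
    have "g (scale c (inv_into UNIV g v)) = scale c v"
      by (simp add: g.scale surj_f_inv_f[OF s])
    then show "inv_into UNIV g (scale c v) = scale c (inv_into UNIV g v)"
      using inv_f_f[OF i, of "scale c (inv_into UNIV g v)"] by simp
  qed
qed

lemma group_GL:
  assumes "vector_space scale"
  shows "group (GL scale)"
proof (rule groupI)
  interpret vector_space scale by fact
  interpret vector_space_pair scale scale ..
  show "g \<otimes>\<^bsub>GL scale\<^esub> h \<in> carrier (GL scale)" if "g \<in> carrier (GL scale)" "h \<in> carrier (GL scale)" for g h
    using that Vector_Spaces.linear_compose[of scale scale h scale g] by (simp add: GL_simps bij_comp)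
  show "\<one>\<^bsub>GL scale\<^esub> \<in> carrier (GL scale)"
    using linear_id unfolding GL_simps by (simp add: bij_id[unfolded id_def] id_def)
  show "\<exists>y\<in>carrier (GL scale). y \<otimes>\<^bsub>GL scale\<^esub> g = \<one>\<^bsub>GL scale\<^esub>" if "g \<in> carrier (GL scale)" for g
    using that linear_inv_into[OF assms, of g]
    by (intro bexI[of _ "inv_into UNIV g"]) (auto simp: GL_simps bij_imp_bij_inv bij_is_inj)
qed (simp_all add: GL_simps comp_assoc)

lemma dual_act_id [simp]: "dual_act id = id"
  by (simp add: dual_act_def fun_eq_iff inv_id)

text \<open>Inversion reverses the product once and precomposition reverses it again, so the dual
  action is a left action.\<close>

lemma dual_act_comp: "bij g \<Longrightarrow> bij h \<Longrightarrow> dual_act (g \<circ> h) w = dual_act g (dual_act h w)"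
  by (simp add: dual_act_def fun_eq_iff o_inv_distrib)

lemma dual_act_add: "dual_act g (u + w) = dual_act g u + dual_act g w"
  by (simp add: dual_act_def fun_eq_iff)

lemma dual_act_scale: "dual_act g (dual_scale c w) = dual_scale c (dual_act g w)"
  by (simp add: dual_act_def dual_scale_def)

lemma dual_act_sum: "dual_act g (sum f A) = (\<Sum>a\<in>A. dual_act g (f a))"
  by (induction A rule: infinite_finite_induct) (simp_all add: dual_act_add, simp_all add: dual_act_def fun_eq_iff)

lemma dual_act_dual:
  assumes "vector_space scale" "g \<in> carrier (GL scale)" "w \<in> dual scale"
  shows "dual_act g w \<in> dual scale"
  using Vector_Spaces.linear_compose[OF linear_inv_into[OF assms(1), of g], of "(*)" w] assms(2,3)
  by (simp add: dual_def GL_simps dual_act_def comp_def)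

lemma rename_vars_comp:
  "bij g \<Longrightarrow> bij h \<Longrightarrow> rename_vars (dual_act (g \<circ> h)) p = rename_vars (dual_act g) (rename_vars (dual_act h) p)"
  by (simp add: rename_vars_eq_subst subst_subst dual_act_comp)

lemma rename_vars_id: "rename_vars id p = p"
  by (simp add: rename_vars_eq_subst subst_indet_ident[of p UNIV] polys_def)

lemma sym_act_comp: "bij g \<Longrightarrow> bij h \<Longrightarrow> sym_act (g \<circ> h) s = sym_act g (sym_act h s)"
  by (simp add: sym_act_def image_image rename_vars_comp)

lemma sym_act_id: "sym_act id s = s"
  unfolding sym_act_def dual_act_id rename_vars_id by simp

text \<open>The elements fixing \<open>s\<close> are closed under products and inverses, so
  invariance need only be tested on generators.\<close>

lemma sym_act_generate:
  assumes "vector_space scale" "K \<subseteq> carrier (GL scale)" "\<And>g. g \<in> K \<Longrightarrow> sym_act g s = s"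
    "g \<in> generate (GL scale) K"
  shows "sym_act g s = s"
proof -
  interpret group "GL scale" by (rule group_GL[OF assms(1)])
  have bij: "bij h" if "h \<in> carrier (GL scale)" for h using that by (simp add: GL_simps)
  note gc = generate_in_carrier[OF assms(2)]
  from assms(4) show ?thesis
  proof (induction rule: generate.induct)
    case one
    show ?case unfolding GL_simps by (rule sym_act_id)
  next
    case (incl h)
    then show ?case by (rule assms(3))
  next
    case (inv h)
    then have h: "h \<in> carrier (GL scale)" using assms(2) by auto
    have "inv\<^bsub>GL scale\<^esub> h \<circ> h = id"
      using l_inv[OF h] by (simp add: GL_simps)
    then have "sym_act (inv\<^bsub>GL scale\<^esub> h) (sym_act h s) = s"
      using sym_act_comp[OF bij[OF inv_closed[OF h]] bij[OF h], of s] by (simp add: sym_act_id)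
    then show ?case using assms(3)[OF inv] by simp
  next
    case (eng h1 h2)
    have "h1 \<otimes>\<^bsub>GL scale\<^esub> h2 = h1 \<circ> h2" by (simp add: GL_def)
    then show ?case using sym_act_comp[OF bij[OF gc] bij[OF gc], OF eng(1,2), of s] eng by (simp only:)
  qed
qed

section \<open>Coordinates on the dual space and on its symmetric algebra\<close>

locale dual_coordinates =
  fixes scale :: "'k::field \<Rightarrow> 'v::ab_group_add \<Rightarrow> 'v" and n :: nat and x :: "nat \<Rightarrow> 'v \<Rightarrow> 'k"
  assumes vector_space_scale: "vector_space scale" and basis: "ordered_dual_basis scale n x"
begin

abbreviation "W \<equiv> dual scale"

definition coord :: "nat \<Rightarrow> ('v \<Rightarrow> 'k) \<Rightarrow> 'k" where
  "coord j w = dual_vs.representation (x ` {1..n}) w (x j)"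

lemma indep: "dual_vs.independent (x ` {1..n})" and span: "dual_vs.span (x ` {1..n}) = W"
  and inj_x: "inj_on x {1..n}"
  using basis by (auto simp: ordered_dual_basis_def)

lemma x_dual: "i \<in> {1..n} \<Longrightarrow> x i \<in> W"
  using span dual_vs.span_base[of "x i" "x ` {1..n}"] by auto

lemma W_add: "u \<in> W \<Longrightarrow> w \<in> W \<Longrightarrow> u + w \<in> W"
  using span dual_vs.span_add by blast

lemma W_diff: "u \<in> W \<Longrightarrow> w \<in> W \<Longrightarrow> u - w \<in> W"
  using span dual_vs.span_diff by blast

lemma W_scale: "w \<in> W \<Longrightarrow> dual_scale c w \<in> W"
  using span dual_vs.span_scale by blast

lemma W_0: "0 \<in> W"
  using span dual_vs.span_zero by blast

lemma W_sum: "(\<And>i. i \<in> A \<Longrightarrow> f i \<in> W) \<Longrightarrow> sum f A \<in> W"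
  using span dual_vs.span_sum[of A f "x ` {1..n}"] by blast

lemma coord_add: "u \<in> W \<Longrightarrow> w \<in> W \<Longrightarrow> coord j (u + w) = coord j u + coord j w"
  unfolding coord_def using indep span by (subst dual_vs.representation_add) auto

lemma coord_scale: "w \<in> W \<Longrightarrow> coord j (dual_scale c w) = c * coord j w"
  unfolding coord_def using indep span by (subst dual_vs.representation_scale) auto

lemma coord_x: "i \<in> {1..n} \<Longrightarrow> j \<in> {1..n} \<Longrightarrow> coord j (x i) = (if i = j then 1 else 0)"
  unfolding coord_def
  by (simp only: dual_vs.representation_basis[OF indep imageI] inj_on_eq_iff[OF inj_x] eq_commute)

lemma coord_sum: "w \<in> W \<Longrightarrow> (\<Sum>j\<in>{1..n}. dual_scale (coord j w) (x j)) = w"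
proof -
  assume "w \<in> W"
  then have "(\<Sum>v\<in>x ` {1..n}. dual_scale (dual_vs.representation (x ` {1..n}) w v) v) = w"
    by (intro dual_vs.sum_representation_eq) (simp_all only: indep span finite_imageI finite_atLeastAtMost order_refl not_False_eq_True)
  then show ?thesis
    by (simp only: sum.reindex[OF inj_x] comp_def coord_def)
qed

text \<open>A function outside \<open>W\<close> has all coordinates 0 and is sent to 0, so
  \<open>to_coords\<close> takes values in \<open>polys {1..n}\<close> on every argument.\<close>

definition lin :: "('v \<Rightarrow> 'k) \<Rightarrow> (nat, 'k) mpolynomial" where
  "lin w = (\<Sum>j\<in>{1..n}. const_poly (coord j w) * indet j)"

interpretation const: ring_map const_poly
  by (rule ring_map_const_poly)

lemma lin_polys: "lin w \<in> polys {1..n}"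
  unfolding lin_def by (intro polys_sum polys_mult polys_const polys_indet)

lemma lin_add: "u \<in> W \<Longrightarrow> w \<in> W \<Longrightarrow> lin (u + w) = lin u + lin w"
  by (simp add: lin_def coord_add const.map_add distrib_right sum.distrib)

lemma lin_scale: "w \<in> W \<Longrightarrow> lin (dual_scale c w) = const_poly c * lin w"
  by (simp add: lin_def coord_scale const.map_mult sum_distrib_left mult.assoc)

lemma lin_x: "i \<in> {1..n} \<Longrightarrow> lin (x i) = indet i"
proof -
  assume i: "i \<in> {1..n}"
  have "lin (x i) = (\<Sum>j\<in>{1..n}. if i = j then indet j else 0)"
    unfolding lin_def by (rule sum.cong) (auto simp: coord_x[OF i] const.map_one const.map_zero)
  then show ?thesis using i by simp
qed

lemma lin_diff: "u \<in> W \<Longrightarrow> w \<in> W \<Longrightarrow> lin (u - w) = lin u - lin w"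
  using lin_add[of "u - w" w] W_diff[of u w] by (simp add: eq_diff_eq)

lemma lin_0: "lin 0 = 0"
  using lin_diff[OF W_0 W_0] by simp

lemma lin_sum: "(\<And>i. i \<in> A \<Longrightarrow> f i \<in> W) \<Longrightarrow> lin (sum f A) = (\<Sum>i\<in>A. lin (f i))"
  by (induction A rule: infinite_finite_induct) (auto simp: lin_0 lin_add W_sum)

definition to_coords :: "('v \<Rightarrow> 'k, 'k) mpolynomial \<Rightarrow> (nat, 'k) mpolynomial" where
  "to_coords = subst lin"

text \<open>A section of \<open>to_coords\<close>: one composite is the identity on
  \<open>polys {1..n}\<close>, the other is the identity on \<open>polys W\<close> only modulo
  \<open>I\<close>.\<close>

definition of_coords :: "(nat, 'k) mpolynomial \<Rightarrow> ('v \<Rightarrow> 'k, 'k) mpolynomial" where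
  "of_coords = subst (\<lambda>i. indet (x i))"

sublocale to: ring_map to_coords
  unfolding to_coords_def by (rule ring_map_subst)

sublocale of: ring_map of_coords
  unfolding of_coords_def by (rule ring_map_subst)

lemma to_coords_polys: "to_coords p \<in> polys {1..n}"
  unfolding to_coords_def by (rule polys_subst[of _ UNIV]) (simp_all only: lin_polys, simp add: polys_def)

lemma of_coords_polys: "p \<in> polys {1..n} \<Longrightarrow> of_coords p \<in> polys W"
  unfolding of_coords_def by (rule polys_subst) (auto intro!: polys_indet x_dual)

lemma to_of_coords: "p \<in> polys {1..n} \<Longrightarrow> to_coords (of_coords p) = p"
  unfolding to_coords_def of_coords_def subst_subst by (rule subst_indet_ident) (auto simp: lin_x)

abbreviation "I \<equiv> sym_ideal dual_scale W"

lemma gens_subset: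
  "{indet (u + w) - (indet u + indet w) | u w. u \<in> W \<and> w \<in> W} \<union>
   {indet (dual_scale c w) - const_poly c * indet w | c w. w \<in> W} \<subseteq> carrier (poly_ring W)"
  by (auto simp: poly_ring_simps intro!: polys_diff polys_add polys_mult polys_indet W_add W_scale)

lemma ideal_I: "ideal I (poly_ring W)"
proof -
  interpret cring "poly_ring W" by (rule cring_poly_ring)
  show ?thesis unfolding sym_ideal_def by (rule genideal_ideal[OF gens_subset])
qed

lemma I_gens:
  "u \<in> W \<Longrightarrow> w \<in> W \<Longrightarrow> indet (u + w) - (indet u + indet w) \<in> I"
  "w \<in> W \<Longrightarrow> indet (dual_scale c w) - const_poly c * indet w \<in> I"
proof -
  interpret cring "poly_ring W" by (rule cring_poly_ring)
  show "u \<in> W \<Longrightarrow> w \<in> W \<Longrightarrow> indet (u + w) - (indet u + indet w) \<in> I"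
    "w \<in> W \<Longrightarrow> indet (dual_scale c w) - const_poly c * indet w \<in> I"
    unfolding sym_ideal_def using genideal_self[OF gens_subset] by blast+
qed

interpretation I: ideal I "poly_ring W"
  by (rule ideal_I)

lemma I_polys: "p \<in> I \<Longrightarrow> p \<in> polys W"
  using I.a_subset by (auto simp: poly_ring_simps)

lemma I_add: "p \<in> I \<Longrightarrow> q \<in> I \<Longrightarrow> p + q \<in> I"
  using additive_subgroup.a_closed[OF I.additive_subgroup_axioms] by (simp add: poly_ring_simps)

lemma I_0: "0 \<in> I"
  using additive_subgroup.zero_closed[OF I.additive_subgroup_axioms] by (simp add: poly_ring_simps)

lemma I_mult: "p \<in> I \<Longrightarrow> q \<in> polys W \<Longrightarrow> p * q \<in> I"
  using I.I_r_closed by (simp add: poly_ring_simps)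

lemma I_uminus: "p \<in> I \<Longrightarrow> - p \<in> I"
  using I_mult[of p "- 1"] by (simp add: polys_uminus)

lemma I_sum: "(\<And>a. a \<in> A \<Longrightarrow> f a \<in> I) \<Longrightarrow> sum f A \<in> I"
  by (induction A rule: infinite_finite_induct) (simp_all add: I_0 I_add)

text \<open>The kernel is an ideal that contains the defining relations, because \<open>lin\<close>
  is linear on \<open>W\<close>.\<close>

lemma to_coords_I: "p \<in> I \<Longrightarrow> to_coords p = 0"
proof -
  interpret cring "poly_ring W" by (rule cring_poly_ring)
  let ?K = "{p \<in> polys W. to_coords p = 0}"
  have "ideal ?K (poly_ring W)"
  proof (rule idealI)
    show "subgroup ?K (add_monoid (poly_ring W))"
      by (rule add.subgroupI)
        (auto simp: poly_ring_simps polys_add poly_ring_a_inv polys_uminus to.map_add to.map_uminus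
          to.map_zero simp flip: a_inv_def intro!: exI[of _ 0])
  qed (auto simp: poly_ring_simps polys_mult to.map_mult ring_axioms)
  then have "I \<subseteq> ?K"
    unfolding sym_ideal_def
  proof (rule genideal_minimal)
    show "{indet (u + w) - (indet u + indet w) | u w. u \<in> W \<and> w \<in> W} \<union>
      {indet (dual_scale c w) - const_poly c * indet w | c w. w \<in> W} \<subseteq> ?K"
      using gens_subset
      by (auto simp: poly_ring_simps to.map_diff to.map_add to.map_mult)
        (auto simp: to_coords_def lin_add lin_scale)
  qed
  then show "p \<in> I \<Longrightarrow> to_coords p = 0" by auto
qed

lemma indet_sum_I: "(\<And>i. i \<in> A \<Longrightarrow> f i \<in> W) \<Longrightarrow> indet (sum f A) - (\<Sum>i\<in>A. indet (f i)) \<in> I"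
proof (induction A rule: infinite_finite_induct)
  case (insert a A)
  have "indet (f a + sum f A) - (indet (f a) + indet (sum f A)) \<in> I"
    using insert by (intro I_gens W_sum) auto
  moreover have "indet (sum f A) - (\<Sum>i\<in>A. indet (f i)) \<in> I" using insert by auto
  ultimately have "(indet (f a + sum f A) - (indet (f a) + indet (sum f A))) +
    (indet (sum f A) - (\<Sum>i\<in>A. indet (f i))) \<in> I" by (rule I_add)
  moreover have "(indet (f a + sum f A) - (indet (f a) + indet (sum f A))) +
    (indet (sum f A) - S) = indet (f a + sum f A) - (indet (f a) + S)" for S :: "('v \<Rightarrow> 'k, 'k) mpolynomial"
    by (simp only: diff_conv_add_uminus minus_add_distrib ac_simps) simp
  ultimately show ?case
    unfolding sum.insert[OF insert(1,2)] by (simp only:)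
\<comment> \<open>For an empty sum, \<open>indet 0\<close> lies in \<open>I\<close> by the scaling
  relation with scalar 0.\<close>
qed (use I_gens(2)[OF W_0, of 0] in \<open>simp_all add: const.map_zero dual_scale_def zero_fun_def\<close>)

text \<open>Modulo \<open>I\<close>, the variable of a functional is the corresponding combination
  of the variables of the basis; sums and products follow. With \<open>to_coords_I\<close> this
  identifies \<open>I\<close> with the kernel of \<open>to_coords\<close> on
  \<open>polys W\<close>.\<close>

lemma of_to_coords: "p \<in> polys W \<Longrightarrow> of_coords (to_coords p) - p \<in> I"
proof (induction p rule: polys_induct)
  case (const c)
  then show ?case by (simp add: of_coords_def to_coords_def I_0)
next
  case (indet w)
  have 1: "(\<Sum>j\<in>{1..n}. indet (dual_scale (coord j w) (x j)) - const_poly (coord j w) * indet (x j)) \<in> I"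
    by (intro I_sum I_gens x_dual)
  have 2: "indet (\<Sum>j\<in>{1..n}. dual_scale (coord j w) (x j)) - (\<Sum>j\<in>{1..n}. indet (dual_scale (coord j w) (x j))) \<in> I"
    by (intro indet_sum_I W_scale x_dual)
  have "of_coords (to_coords (indet w)) = (\<Sum>j\<in>{1..n}. const_poly (coord j w) * indet (x j))"
    by (simp add: to_coords_def lin_def of.map_sum of.map_mult) (simp add: of_coords_def)
  then show ?case
    using I_uminus[OF I_add[OF 1 2]] unfolding coord_sum[OF indet] sum_subtractf by simp
next
  case (add p q)
  then show ?case
    using I_add[of "of_coords (to_coords p) - p" "of_coords (to_coords q) - q"]
    by (simp add: to.map_add of.map_add algebra_simps)
next
  case (mult p q)
  have "of_coords (to_coords (p * q)) - p * q =
    (of_coords (to_coords p) - p) * of_coords (to_coords q) + (of_coords (to_coords q) - q) * p"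
    by (simp add: to.map_mult of.map_mult algebra_simps)
  then show ?case
    unfolding \<open>_ = _\<close> using mult by (intro I_add I_mult of_coords_polys to_coords_polys)
qed

section \<open>Cosets as fibres of the coordinate map\<close>

definition cls :: "(nat, 'k) mpolynomial \<Rightarrow> ('v \<Rightarrow> 'k, 'k) mpolynomial set" where
  "cls f = {q \<in> polys W. to_coords q = f}"

text \<open>Two polynomials in one fibre differ by an element of \<open>I\<close>, by
  \<open>of_to_coords\<close>. Elements of the symmetric algebra are thereby indexed by polynomials
  in \<open>n\<close> variables.\<close>

lemma coset_eq_cls:
  assumes "p \<in> polys W"
  shows "I +>\<^bsub>poly_ring W\<^esub> p = cls (to_coords p)"
proof
  show "I +>\<^bsub>poly_ring W\<^esub> p \<subseteq> cls (to_coords p)"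
    using assms by (auto simp: a_r_coset_def' poly_ring_simps cls_def to.map_add to_coords_I
        dest: I_polys intro: polys_add)
  show "cls (to_coords p) \<subseteq> I +>\<^bsub>poly_ring W\<^esub> p"
  proof
    fix q assume "q \<in> cls (to_coords p)"
    then have q: "q \<in> polys W" "to_coords q = to_coords p" by (auto simp: cls_def)
    have "(of_coords (to_coords p) - p) + (- (of_coords (to_coords q) - q)) \<in> I"
      by (intro I_add I_uminus of_to_coords assms q)
    then have "q - p \<in> I" using q(2) by simp
    then show "q \<in> I +>\<^bsub>poly_ring W\<^esub> p"
      by (auto simp: a_r_coset_def' poly_ring_simps intro!: bexI[of _ "q - p"])
  qed
qed

lemma cls_eq_coset: "f \<in> polys {1..n} \<Longrightarrow> cls f = I +>\<^bsub>poly_ring W\<^esub> of_coords f"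
  using coset_eq_cls[OF of_coords_polys, of f] to_of_coords[of f] by simp

lemma of_coords_cls: "f \<in> polys {1..n} \<Longrightarrow> of_coords f \<in> cls f"
  by (simp add: cls_def of_coords_polys to_of_coords)

lemma inj_cls: "inj_on cls (polys {1..n})"
proof (rule inj_onI)
  fix f g assume "f \<in> polys {1..n}" "g \<in> polys {1..n}" "cls f = cls g"
  then show "f = g" using of_coords_cls[of f] to_of_coords[of f] by (simp add: cls_def)
qed

lemma carrier_Sym: "carrier (Sym_dual scale) = cls ` polys {1..n}"
proof -
  have "carrier (Sym_dual scale) = (\<lambda>p. I +>\<^bsub>poly_ring W\<^esub> p) ` polys W"
    by (auto simp: Sym_dual_def sym_algebra_def FactRing_def A_RCOSETS_def' poly_ring_simps)
  also have "\<dots> = cls ` (to_coords ` polys W)"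
    by (auto simp: coset_eq_cls image_image)
  also have "to_coords ` polys W = polys {1..n}"
    using to_coords_polys of_coords_polys to_of_coords by (force simp: image_iff)
  finally show ?thesis .
qed

lemma Sym_add: "f \<in> polys {1..n} \<Longrightarrow> g \<in> polys {1..n} \<Longrightarrow> cls f \<oplus>\<^bsub>Sym_dual scale\<^esub> cls g = cls (f + g)"
  by (simp add: cls_eq_coset polys_add of.map_add Sym_dual_def sym_algebra_def FactRing_def
      I.a_rcos_sum poly_ring_simps of_coords_polys)

lemma Sym_mult: "f \<in> polys {1..n} \<Longrightarrow> g \<in> polys {1..n} \<Longrightarrow> cls f \<otimes>\<^bsub>Sym_dual scale\<^esub> cls g = cls (f * g)"
  by (simp add: cls_eq_coset polys_mult of.map_mult Sym_dual_def sym_algebra_def FactRing_def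
      I.rcoset_mult_add poly_ring_simps of_coords_polys)

lemma Sym_one: "\<one>\<^bsub>Sym_dual scale\<^esub> = cls 1"
  by (simp add: cls_eq_coset of.map_one Sym_dual_def sym_algebra_def FactRing_def poly_ring_simps)

lemma Sym_zero: "\<zero>\<^bsub>Sym_dual scale\<^esub> = cls 0"
proof -
  have "cls 0 = I"
    using cls_eq_coset[of 0] by (auto simp: of.map_zero a_r_coset_def' poly_ring_simps)
  then show ?thesis by (simp add: Sym_dual_def sym_algebra_def FactRing_def)
qed

lemma sym_constant_cls: "sym_constant dual_scale W c = cls (const_poly c)"
  by (simp add: sym_constant_def coset_eq_cls) (simp add: to_coords_def)

section \<open>The group action in coordinates\<close>

definition action :: "('v \<Rightarrow> 'v) \<Rightarrow> nat \<Rightarrow> (nat, 'k) mpolynomial" where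
  "action g i = lin (dual_act g (x i))"

text \<open>It suffices to compare both sides on a functional \<open>w\<close>, where expanding
  \<open>w\<close> in the basis and linearity of the dual action give the claim.\<close>

lemma to_coords_rename:
  assumes "g \<in> carrier (GL scale)" "q \<in> polys W"
  shows "to_coords (rename_vars (dual_act g) q) = subst (action g) (to_coords q)"
proof -
  note gW = dual_act_dual[OF vector_space_scale assms(1)]
  have "lin (dual_act g w) = subst (action g) (lin w)" if w: "w \<in> W" for w
  proof -
    have "dual_act g w = (\<Sum>j\<in>{1..n}. dual_scale (coord j w) (dual_act g (x j)))"
      using arg_cong[OF coord_sum[OF w], of "dual_act g"] by (simp only: dual_act_sum dual_act_scale)
    then have "lin (dual_act g w) = lin (\<Sum>j\<in>{1..n}. dual_scale (coord j w) (dual_act g (x j)))"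
      by (rule arg_cong)
    also have "\<dots> = (\<Sum>j\<in>{1..n}. const_poly (coord j w) * action g j)"
      by (subst lin_sum) (auto simp only: W_scale lin_scale action_def gW x_dual intro!: sum.cong)
    also have "\<dots> = subst (action g) (lin w)"
      by (simp add: lin_def ring_map.map_sum[OF ring_map_subst] ring_map.map_mult[OF ring_map_subst])
    finally show ?thesis .
  qed
  then show ?thesis
    unfolding to_coords_def rename_vars_eq_subst subst_subst
    using assms(2) by (intro subst_cong[of _ W]) auto
qed

lemma rename_polys:
  assumes "g \<in> carrier (GL scale)" "q \<in> polys W"
  shows "rename_vars (dual_act g) q \<in> polys W"
  unfolding rename_vars_eq_subst using dual_act_dual[OF vector_space_scale assms(1)] assms(2)
  by (intro polys_subst[of _ W] polys_indet)

text \<open>\<open>sym_act\<close> is an image of a set, so equality needs two inclusions. If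
  \<open>f\<close> is fixed, renaming along \<open>g\<close> maps \<open>cls f\<close> into itself;
  the inverse of \<open>g\<close> fixes \<open>f\<close> too and provides preimages.\<close>

lemma sym_act_cls:
  assumes g: "g \<in> carrier (GL scale)" and f: "f \<in> polys {1..n}"
  shows "sym_act g (cls f) = cls f \<longleftrightarrow> subst (action g) f = f"
proof
  assume "sym_act g (cls f) = cls f"
  then have "rename_vars (dual_act g) (of_coords f) \<in> cls f"
    using of_coords_cls[OF f] by (auto simp: sym_act_def)
  then show "subst (action g) f = f"
    using to_coords_rename[OF g of_coords_polys[OF f]] f by (simp add: cls_def to_of_coords)
next
  assume inv: "subst (action g) f = f"
  interpret GL: group "GL scale" by (rule group_GL[OF vector_space_scale])
  define h where "h = inv\<^bsub>GL scale\<^esub> g"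
  have h: "h \<in> carrier (GL scale)" using g by (simp add: h_def)
  have gh: "g \<circ> h = id" "h \<circ> g = id"
    using GL.r_inv[OF g] GL.l_inv[OF g] by (simp_all add: h_def GL_simps)
  have bij: "bij g" "bij h" using g h by (simp_all add: GL_simps)
  have "subst (action h) f = f"
  proof -
    let ?q = "of_coords f"
    have "f = to_coords (rename_vars (dual_act h) (rename_vars (dual_act g) ?q))"
      using rename_vars_comp[OF bij(2,1), of ?q] f by (simp add: gh rename_vars_id to_of_coords)
    also have "\<dots> = subst (action h) (subst (action g) f)"
      using f by (simp add: to_coords_rename g h rename_polys of_coords_polys to_of_coords)
    finally show ?thesis using inv by simp
  qed
  then have sub: "rename_vars (dual_act k) q \<in> cls f" if "q \<in> cls f" "k = g \<or> k = h" for k q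
    using that inv g h by (auto simp: cls_def rename_polys to_coords_rename)
  have "q \<in> sym_act g (cls f)" if "q \<in> cls f" for q
    unfolding sym_act_def
  proof (rule image_eqI)
    show "q = rename_vars (dual_act g) (rename_vars (dual_act h) q)"
      using rename_vars_comp[OF bij, of q] by (simp add: gh rename_vars_id)
  qed (use sub that in blast)
  then show "sym_act g (cls f) = cls f"
    using sub by (auto simp: sym_act_def)
qed

lemma action_diff:
  assumes "g \<in> carrier (GL scale)" "i \<in> {1..n}"
  shows "action g i - indet i = lin (dual_act g (x i) - x i)"
  using dual_act_dual[OF vector_space_scale assms(1) x_dual[OF assms(2)]] x_dual[OF assms(2)] lin_x[OF assms(2)]
  by (simp add: action_def lin_diff)

lemma lin_homogeneous: "homogeneous 1 (lin w)"
proof -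
  have "homogeneous 1 (const_poly c * indet j :: (nat, 'k) mpolynomial)" for c j
    by (simp add: const_poly_def indet_def mult_single homogeneous_single)
  then have "homogeneous 1 (\<Sum>j\<in>A. const_poly (coord j w) * indet j)" for A
    by (induction A rule: infinite_finite_induct) (simp_all add: homogeneous_add)
  then show ?thesis by (simp only: lin_def)
qed

lemma lin_polys_of_coord:
  assumes "\<And>j. j \<in> {1..n} \<Longrightarrow> coord j w \<noteq> 0 \<Longrightarrow> j \<le> c"
  shows "lin w \<in> polys {1..c}"
  unfolding lin_def
proof (rule polys_sum)
  fix j assume j: "j \<in> {1..n}"
  show "const_poly (coord j w) * indet j \<in> polys {1..c}"
  proof (cases "coord j w = 0")
    case False
    then show ?thesis using assms[OF j False] j by (intro polys_mult polys_const polys_indet) auto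
  qed (simp add: const_poly_def)
qed

lemma coord_le_beta:
  assumes "i \<in> {1..n}" "j \<in> {1..n}" "coord j (dual_act g (x i) - x i) \<noteq> 0"
  shows "j \<le> nakajima_beta n x g"
  unfolding nakajima_beta_def using assms by (intro Max_ge) (auto simp: coord_def)

text \<open>By \<open>coord_le_beta\<close>, the bound on \<open>nakajima_beta\<close> says that the
  added linear form involves only variables up to \<open>l\<close>.\<close>

lemma action_block:
  assumes "g \<in> carrier (GL scale)" "i \<in> {1..n}" "action g i \<noteq> indet i"
    and "\<forall>i\<in>{1..n}. dual_act g (x i) \<noteq> x i \<longrightarrow> l < i \<and> i \<le> u \<and> nakajima_beta n x g \<le> l"
  shows "i \<in> {l<..u} \<and> action g i - indet i \<in> polys {1..l} \<and> homogeneous 1 (action g i - indet i)"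
proof -
  have "dual_act g (x i) \<noteq> x i"
    using assms(3) lin_x[OF assms(2)] by (auto simp: action_def)
  then have *: "l < i" "i \<le> u" "nakajima_beta n x g \<le> l"
    using assms(2,4) by blast+
  show ?thesis
    unfolding action_diff[OF assms(1,2)]
  proof (intro conjI lin_homogeneous lin_polys_of_coord)
    show "j \<le> l" if "j \<in> {1..n}" "coord j (dual_act g (x i) - x i) \<noteq> 0" for j
      using coord_le_beta[OF assms(2) that] *(3) by simp
  qed (use * in auto)
qed

end

section \<open>From generalised Nakajima groups to block substitutions\<close>

theorem corollary1p3:
  fixes scale :: "'k::field \<Rightarrow> 'v::ab_group_add \<Rightarrow> 'v"
    and B :: "'v set" and n p :: nat and G :: "('v \<Rightarrow> 'v) set"
  assumes "CHAR('k) = p" and "p > 0"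
    and "finite_dimensional_vector_space scale B" and "card B = n"
    and "subgroup G (GL scale)" and "finite G" and "\<exists>a. card G = p ^ a"
    and "generalised_nakajima scale n G"
    and "direct_summand (carrier (invariant_ring scale G)) (invariant_ring scale G)
           (regular_module (Sym_dual scale))"
  shows "is_polynomial_algebra (sym_constant dual_scale (dual scale)) (invariant_ring scale G)"
proof -
  have vs: "vector_space scale"
    using assms(3) by (simp add: finite_dimensional_vector_space_def)
  obtain x idx r where x: "ordered_dual_basis scale n x" and idx: "1 \<le> idx 0"
      "\<And>k. k < r \<Longrightarrow> idx k < idx (Suc k)" "idx r \<le> n"
    and G: "G = generate (GL scale) (\<Union>k\<in>{1..r}. nakajima_block scale n G x idx k)"
    using assms(8) unfolding generalised_nakajima_def by blast
  interpret dual_coordinates scale n x by (rule dual_coordinates.intro[OF vs x])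
  interpret GL: group "GL scale" by (rule group_GL[OF vs])
  define gens where "gens k = {g \<in> G. \<forall>i\<in>{1..n}. dual_act g (x i) \<noteq> x i \<longrightarrow>
      idx (k - 1) < i \<and> i \<le> idx k \<and> nakajima_beta n x g \<le> idx (k - 1)}" for k
  have GGL: "G \<subseteq> carrier (GL scale)" by (rule subgroup.subset[OF assms(5)])
  have gens_GL: "gens k \<subseteq> carrier (GL scale)" for k using GGL by (auto simp: gens_def)
  define H where "H = action ` (\<Union>k\<in>{1..r}. gens k)"
  \<comment> \<open>The indices are shifted by one: \<open>b k\<close> is \<open>idx (k - 1)\<close>
    for \<open>k\<close> from 1 to \<open>r + 1\<close>, with \<open>b 0 = 0\<close> and
    \<open>b (r + 2) = n\<close> added. The first and the last of the \<open>r + 2\<close> blocks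
    are fixed by all generators.\<close>
  define b where "b l = (if l = 0 then 0 else if l \<le> Suc r then idx (l - 1) else n)" for l
  interpret block_substitutions b "r + 2" n H
  proof
    fix \<phi> assume "\<phi> \<in> H"
    then obtain k g where k: "k \<in> {1..r}" "g \<in> gens k" "\<phi> = action g" by (auto simp: H_def)
    then have bk: "b k = idx (k - 1)" "b (Suc k) = idx k" by (auto simp: b_def)
    have "g \<in> carrier (GL scale)" using k(2) gens_GL by blast
    then have "\<forall>i\<in>{1..n}. \<phi> i \<noteq> indet i \<longrightarrow>
      i \<in> {b k<..b (Suc k)} \<and> \<phi> i - indet i \<in> polys {1..b k} \<and> homogeneous 1 (\<phi> i - indet i)"
      using k(2) unfolding k(3) bk gens_def mem_Collect_eq by (intro ballI impI action_block) simp_all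
    then show "\<exists>l<r + 2. \<forall>i\<in>{1..n}. \<phi> i \<noteq> indet i \<longrightarrow>
      i \<in> {b l<..b (Suc l)} \<and> \<phi> i - indet i \<in> polys {1..b l} \<and> homogeneous 1 (\<phi> i - indet i)"
      using k(1) by (intro exI[of _ k]) auto
  next
    fix l assume "l < r + 2"
    show "b l \<le> b (Suc l)"
    proof (cases l)
      case (Suc k)
      then show ?thesis using idx(2)[of k] idx(3) \<open>l < r + 2\<close> by (cases "k < r") (auto simp: b_def less_Suc_eq)
    qed (simp add: b_def)
  qed (simp_all add: b_def)
  define A where "A = carrier (invariant_ring scale G)"
  \<comment> \<open>Generation happens in two layers, the sets \<open>gens k\<close> generating
    subgroups and these generating \<open>G\<close>, so \<open>sym_act_generate\<close> is applied
    twice.\<close>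
  have invs_iff: "f \<in> invs (r + 2) \<longleftrightarrow> (\<forall>g\<in>G. sym_act g (cls f) = cls f)" if f: "f \<in> polys {1..n}" for f
  proof -
    have "f \<in> invs (r + 2) \<longleftrightarrow> (\<forall>\<phi>\<in>H. subst \<phi> f = f)"
      unfolding invs_def b_N mem_Collect_eq using f by simp
    also have "\<dots> \<longleftrightarrow> (\<forall>k\<in>{1..r}. \<forall>g\<in>gens k. subst (action g) f = f)"
      unfolding H_def by blast
    also have "\<dots> \<longleftrightarrow> (\<forall>k\<in>{1..r}. \<forall>g\<in>gens k. sym_act g (cls f) = cls f)"
      by (intro ball_cong refl sym_act_cls[OF _ f, symmetric] subsetD[OF gens_GL])
    also have "\<dots> \<longleftrightarrow> (\<forall>g\<in>G. sym_act g (cls f) = cls f)"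
    proof (intro iffI ballI)
      fix g assume *: "\<forall>k\<in>{1..r}. \<forall>g\<in>gens k. sym_act g (cls f) = cls f" and "g \<in> G"
      have block: "nakajima_block scale n G x idx k = generate (GL scale) (gens k)" for k
        by (simp add: nakajima_block_def gens_def)
      show "sym_act g (cls f) = cls f"
      proof (rule sym_act_generate[OF vs])
        show "g \<in> generate (GL scale) (\<Union>k\<in>{1..r}. nakajima_block scale n G x idx k)"
          using \<open>g \<in> G\<close> G by simp
        show "(\<Union>k\<in>{1..r}. nakajima_block scale n G x idx k) \<subseteq> carrier (GL scale)"
          unfolding block using GL.generate_in_carrier[OF gens_GL] by blast
        show "sym_act g (cls f) = cls f" if "g \<in> (\<Union>k\<in>{1..r}. nakajima_block scale n G x idx k)" for g
          using that * sym_act_generate[OF vs gens_GL] unfolding block by blast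
      qed
    qed (auto simp: gens_def)
    finally show ?thesis .
  qed
  have inv_n: "invs (r + 2) \<subseteq> polys {1..n}" using invs_polys by blast
  have A: "A = cls ` invs (r + 2)"
    using invs_iff inv_n by (auto simp: A_def invariant_ring_def carrier_Sym)
  obtain Q where Q: "submodule Q (invariant_ring scale G) (regular_module (Sym_dual scale))"
    and Q_A: "A \<inter> Q = {\<zero>\<^bsub>Sym_dual scale\<^esub>}" "set_add (regular_module (Sym_dual scale)) A Q = cls ` polys {1..n}"
    using assms(9) by (auto simp: direct_summand_def A_def regular_module_def carrier_Sym)
  interpret Q: submodule Q "invariant_ring scale G" "regular_module (Sym_dual scale)" by (rule Q)
  have Q_sub: "Q \<subseteq> cls ` polys {1..n}"
    using Q.subset by (simp add: regular_module_def carrier_Sym)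
  have "\<exists>(m::nat) F. bij_betw (subst F) (polys {..<m}) (invs (r + 2))"
  proof (rule invs_polynomial)
    \<comment> \<open>The module complement \<open>Q\<close> is pulled back to coordinates along
      \<open>cls\<close> and serves as \<open>C\<close>.\<close>
    let ?C = "{f \<in> polys {1..n}. cls f \<in> Q}"
    show "f + g \<in> ?C" if "f \<in> ?C" "g \<in> ?C" for f g
      using that Q.m_closed[of "cls f" "cls g"] by (simp add: polys_add regular_module_def Sym_add)
    show "0 \<in> ?C"
      using Q.one_closed by (simp add: regular_module_def Sym_zero)
    show "f * g \<in> ?C" if "f \<in> ?C" "g \<in> invs (r + 2)" for f g
      using that inv_n Q.smult_closed[of "cls g" "cls f"] A
      by (auto simp: polys_mult regular_module_def Sym_mult A_def mult.commute)
    show "f = 0" if "f \<in> invs (r + 2)" "f \<in> ?C" for f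
    proof -
      have "cls f \<in> A \<inter> Q" using that A by auto
      then have "cls f = cls 0" using Q_A(1) by (simp add: Sym_zero)
      then show ?thesis using inj_onD[OF inj_cls, of f 0] that by simp
    qed
    show "\<exists>a\<in>invs (r + 2). f - a \<in> ?C" if f: "f \<in> polys {1..n}" for f
    proof -
      have "cls f \<in> set_add (regular_module (Sym_dual scale)) A Q" using f Q_A(2) by auto
      then obtain a c where a: "a \<in> invs (r + 2)" and c: "c \<in> polys {1..n}" "cls c \<in> Q"
        and eq: "cls f = cls a \<oplus>\<^bsub>Sym_dual scale\<^esub> cls c"
        using Q_sub unfolding A set_add_def set_mult_def by (fastforce simp: regular_module_def)
      have "a \<in> polys {1..n}" using a inv_n by auto
      then have "cls f = cls (a + c)" using eq c by (simp add: Sym_add)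
      then have "f = a + c"
        using inj_onD[OF inj_cls, of f "a + c"] f c \<open>a \<in> polys {1..n}\<close> by (simp add: polys_add)
      then show ?thesis using a c by (intro bexI[of _ a]) auto
    qed
  qed
  then obtain m :: nat and F where F: "bij_betw (subst F) (polys {..<m}) (invs (r + 2))" by blast
  have F_polys: "subst F f \<in> polys {1..n}" if "f \<in> polys {..<m}" for f
    using bij_betwE[OF F] that inv_n by blast
  have "bij_betw (\<lambda>f. cls (subst F f)) (polys {..<m}) A"
    using bij_betw_trans[OF F inj_on_imp_bij_betw[OF inj_on_subset[OF inj_cls inv_n]]]
    by (simp add: A comp_def)
  moreover have "(\<lambda>f. cls (subst F f)) \<in> ring_hom (poly_ring {..<m}) (invariant_ring scale G)"
  proof (rule ring_hom_memI)
    fix f g :: "(nat, 'k) mpolynomial"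
    assume "f \<in> carrier (poly_ring {..<m})" "g \<in> carrier (poly_ring {..<m})"
    then have *: "subst F f \<in> polys {1..n}" "subst F g \<in> polys {1..n}"
      by (simp_all only: poly_ring_simps F_polys)
    show "cls (subst F (f \<otimes>\<^bsub>poly_ring {..<m}\<^esub> g)) = cls (subst F f) \<otimes>\<^bsub>invariant_ring scale G\<^esub> cls (subst F g)"
      "cls (subst F (f \<oplus>\<^bsub>poly_ring {..<m}\<^esub> g)) = cls (subst F f) \<oplus>\<^bsub>invariant_ring scale G\<^esub> cls (subst F g)"
      using Sym_mult[OF *] Sym_add[OF *]
      by (simp_all add: poly_ring_simps invariant_ring_def ring_map.map_add[OF ring_map_subst]
          ring_map.map_mult[OF ring_map_subst])
  next
    fix f :: "(nat, 'k) mpolynomial"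
    assume "f \<in> carrier (poly_ring {..<m})"
    then show "cls (subst F f) \<in> carrier (invariant_ring scale G)"
      using bij_betwE[OF F] A by (auto simp: poly_ring_simps A_def)
  next
    show "cls (subst F \<one>\<^bsub>poly_ring {..<m}\<^esub>) = \<one>\<^bsub>invariant_ring scale G\<^esub>"
      by (simp add: poly_ring_simps invariant_ring_def Sym_one ring_map.map_one[OF ring_map_subst])
  qed
  ultimately have "(\<lambda>f. cls (subst F f)) \<in> ring_iso (poly_ring {..<m}) (invariant_ring scale G)"
    by (simp add: ring_iso_def poly_ring_simps A_def)
  then show ?thesis
    unfolding is_polynomial_algebra_def
    by (intro exI[of _ m] bexI[of _ "\<lambda>f. cls (subst F f)"]) (simp_all add: sym_constant_cls)
qed

end
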